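(* There exists an online list edge-coloring algorithm which, on $n$-vertex simple graphs of known maximum degree $\Delta$, outputs with high probability in $n$ a valid list edge coloring, provided all lists satisfy $|L(e)|\ge \Delta+q$, where $$q := 10^{24}\ln n + 10^4\left(\Delta^{3/4}\ln^{1/2}\Delta + \Delta^{2/3}\ln^{1/3} n\right).$$ In particular, if $\Delta=\omega(\log n)$, then lists of size $\Delta+q$ with $q=o(\Delta)$ suffice.
   Context: Online list edge coloring: edges of a graph arrive one at a time in an order fixed in advance (oblivious adversary); each edge $e$ arrives together with a list $L(e)\subseteq\mathbb{N}$ of allowed colors, and upon arrival must be irrevocably assigned a color $c(e)\in L(e)$ such that no two edges sharing an endpoint receive the same color. "With high probability in $n$" means with probability at least $1-n^{-c}$ for a constant $c>0$. *)

theory Defs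
  imports "HOL-Probability.Probability" "HOL-Library.Landau_Symbols"
begin

type_synonym edge = "nat set"

text \<open>Vertices are natural numbers. Graphs are nonempty, so that \<open>Max\<close> below is meaningful.\<close>

definition simple_graph :: "nat set \<Rightarrow> edge set \<Rightarrow> bool" where
  "simple_graph V E \<longleftrightarrow> finite V \<and> V \<noteq> {} \<and> (\<forall>e\<in>E. e \<subseteq> V \<and> card e = 2)"

definition degree :: "edge set \<Rightarrow> nat \<Rightarrow> nat" where
  "degree E v = card {e \<in> E. v \<in> e}"

definition max_degree :: "nat set \<Rightarrow> edge set \<Rightarrow> nat" where
  "max_degree V E = Max (degree E ` V)"

definition valid_list_edge_coloring ::
    "edge set \<Rightarrow> (edge \<Rightarrow> nat set) \<Rightarrow> (edge \<Rightarrow> nat) \<Rightarrow> bool" where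
  "valid_list_edge_coloring E L c \<longleftrightarrow>
     (\<forall>e\<in>E. c e \<in> L e) \<and>
     (\<forall>e\<in>E. \<forall>f\<in>E. e \<noteq> f \<and> e \<inter> f \<noteq> {} \<longrightarrow> c e \<noteq> c f)"

text \<open>
  A history records, in order of arrival, each edge with its list and its assigned color.
  A randomized strategy maps the history, the arriving edge and its list to the conditional
  distribution of the color of that edge. Since histories record all past observations and
  choices and colors are natural numbers, every randomized online algorithm, whatever internal
  state or source of randomness it uses, induces such a strategy with the same output
  distribution on every fixed input. An algorithm may produce colors violating the
  constraints; such runs count as failures.
\<close>

type_synonym history = "(edge \<times> nat set \<times> nat) list"

type_synonym strategy = "history \<Rightarrow> edge \<Rightarrow> nat set \<Rightarrow> nat pmf"

text \<open>The two numbers given to an algorithm in advance are the number of vertices and the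
  maximum degree.\<close>

type_synonym online_algorithm = "nat \<Rightarrow> nat \<Rightarrow> strategy"

primrec run :: "strategy \<Rightarrow> (edge \<Rightarrow> nat set) \<Rightarrow> history \<Rightarrow> edge list \<Rightarrow> history pmf" where
  "run S L h [] = return_pmf h"
| "run S L h (e # es) =
     bind_pmf (S h e (L e)) (\<lambda>k. run S L (h @ [(e, L e, k)]) es)"

definition coloring_of :: "history \<Rightarrow> edge \<Rightarrow> nat" where
  "coloring_of h e = snd (the (map_of h e))"

definition output_coloring ::
    "strategy \<Rightarrow> (edge \<Rightarrow> nat set) \<Rightarrow> edge list \<Rightarrow> (edge \<Rightarrow> nat) pmf" where
  "output_coloring S L es = map_pmf coloring_of (run S L [] es)"

text \<open>
  The adversary is oblivious: graph, lists and arrival order \<open>es\<close> are fixed before the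
  random choices are made. Lists may be infinite, in which case \<open>card\<close> would be \<open>0\<close>.
\<close>

definition list_size_suffices ::
    "online_algorithm \<Rightarrow> real \<Rightarrow> nat \<Rightarrow> nat \<Rightarrow> real \<Rightarrow> bool" where
  "list_size_suffices A c n \<Delta> s \<longleftrightarrow>
     (\<forall>V E L es.
        simple_graph V E \<and> card V = n \<and> max_degree V E = \<Delta> \<and>
        distinct es \<and> set es = E \<and>
        (\<forall>e\<in>E. infinite (L e) \<or> real (card (L e)) \<ge> s) \<longrightarrow>
        measure_pmf.prob (output_coloring (A n \<Delta>) L es)
          {col. valid_list_edge_coloring E L col} \<ge> 1 - real n powr (- c))"

definition q :: "nat \<Rightarrow> nat \<Rightarrow> real" where
  "q n \<Delta> = 10 ^ 24 * ln (real n) +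
     10 ^ 4 * (real \<Delta> powr (3/4) * ln (real \<Delta>) powr (1/2) +
               real \<Delta> powr (2/3) * ln (real n) powr (1/3))"

end

theory Submission
  imports Defs "HOL-Real_Asymp.Real_Asymp"
begin

text \<open>
  Each vertex \<open>v\<close> and color \<open>c\<close> carry a weight \<open>Z v c\<close>: it is \<open>0\<close> once \<open>c\<close> is used at \<open>v\<close>, and
  otherwise the inverse of the product of \<open>1 - P f c\<close> over the past edges \<open>f\<close> at \<open>v\<close>, where
  \<open>P f c\<close> was the conditional probability that \<open>f\<close> takes \<open>c\<close>. An arriving edge \<open>{u, v}\<close> takes \<open>c\<close>
  with probability proportional to \<open>Z u c * Z v c\<close>. Each such product is a martingale with mean
  \<open>1\<close>, and the algorithm can only fail when the total weight of some arriving edge vanishes.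

  With \<open>N\<close> colors per list and \<open>d\<close> edges seen at \<open>v\<close>, all weights at \<open>v\<close> stay below
  \<open>2 N / (N - d)\<close>. Indeed \<open>1 / Z v c\<close> equals \<open>1\<close> minus the sum of \<open>Z w c / (total weight)\<close> over the
  earlier edges \<open>{v, w}\<close>, and this sum concentrates around \<open>d / N\<close>, while the total weights
  concentrate around \<open>N\<close>. Upper tails of sums of \<open>Z w c\<close> are controlled by products of
  \<open>1 + x - x^2 / 2\<close>: the quadratic term pays for the positive correlation of two neighbours of
  \<open>v\<close> joined by an edge. Lower tails of total weights are controlled by products of
  \<open>1 - lam * Z u c * Z v c\<close> over \<open>c\<close>, because an edge takes exactly one color. The sum \<open>Psi\<close> of these
  products, each divided by its threshold, is a supermartingale until the first violation, where
  it is at least \<open>1\<close>; hence its initial value bounds the failure probability.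

  The errors in the total weights decay with \<open>N - d\<close> and are summed along each vertex. This is
  what gives slack of order \<open>N^(2/3) (ln n)^(1/3)\<close>.
\<close>

section \<open>The weight algorithm\<close>

type_synonym weights = "nat \<Rightarrow> nat \<Rightarrow> real"

definition weight :: "weights \<Rightarrow> edge \<Rightarrow> nat \<Rightarrow> real" where
  "weight Z e c = (\<Prod>v\<in>e. Z v c)"

definition total_weight :: "weights \<Rightarrow> edge \<Rightarrow> nat set \<Rightarrow> real" where
  "total_weight Z e T = (\<Sum>c\<in>T. weight Z e c)"

definition color_prob :: "weights \<Rightarrow> edge \<Rightarrow> nat set \<Rightarrow> nat \<Rightarrow> real" where
  "color_prob Z e T c = weight Z e c / total_weight Z e T"

text \<open>For probabilities below 1, the division by \<open>1 - color_prob Z e T c\<close> offsets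
  the chance that the weight drops to 0, so every entry keeps its conditional mean. At probability 1
  the quotient is 0 by convention, so weights stay nonnegative in all cases.\<close>

definition update :: "weights \<Rightarrow> edge \<Rightarrow> nat set \<Rightarrow> nat \<Rightarrow> weights" where
  "update Z e T k = (\<lambda>v c. if v \<in> e \<and> c \<in> T
     then (if c = k then 0 else Z v c / (1 - color_prob Z e T c)) else Z v c)"

text \<open>The function is a probability distribution only if the total weight is positive, hence
  the analysis must keep total weights away from 0.\<close>

definition color_pmf :: "weights \<Rightarrow> edge \<Rightarrow> nat set \<Rightarrow> nat pmf" where
  "color_pmf Z e T = embed_pmf (\<lambda>c. if c \<in> T then color_prob Z e T c else 0)"

text \<open>A strategy sees nothing but the history, so the weights are recomputed from it;
  \<open>tr\<close> cuts each list down to the colors that the algorithm considers.\<close>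

definition history_weights :: "(nat set \<Rightarrow> nat set) \<Rightarrow> history \<Rightarrow> weights" where
  "history_weights tr = foldl (\<lambda>Z (e, l, k). update Z e (tr l) k) (\<lambda>_ _. 1)"

definition weight_strategy :: "(nat set \<Rightarrow> nat set) \<Rightarrow> strategy" where
  "weight_strategy tr h e l = color_pmf (history_weights tr h) e (tr l)"

lemma weight_nonneg: "(\<And>v c. 0 \<le> Z v c) \<Longrightarrow> 0 \<le> weight Z e c"
  by (simp add: weight_def prod_nonneg)

lemma color_prob_nonneg: "(\<And>v c. 0 \<le> Z v c) \<Longrightarrow> 0 \<le> color_prob Z e T c"
  by (simp add: color_prob_def total_weight_def weight_nonneg sum_nonneg)

lemma color_prob_le_1:
  assumes "\<And>v c. 0 \<le> Z v c" and "c \<in> T"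
  shows "color_prob Z e T c \<le> 1"
proof (cases "finite T")
  case True
  have "weight Z e c \<le> total_weight Z e T"
    unfolding total_weight_def using assms True by (intro member_le_sum) (auto simp: weight_nonneg)
  moreover have "0 \<le> weight Z e c" using assms by (simp add: weight_nonneg)
  ultimately show ?thesis by (auto simp: color_prob_def divide_le_eq)
qed (simp add: color_prob_def total_weight_def)

lemma update_nonneg:
  assumes "\<And>v c. 0 \<le> Z v c"
  shows "0 \<le> update Z e T k v c"
  using assms color_prob_le_1[OF assms] by (auto simp: update_def)

lemma sum_color_prob:
  "0 < total_weight Z e T \<Longrightarrow> (\<Sum>c\<in>T. color_prob Z e T c) = 1"
  by (simp add: color_prob_def total_weight_def flip: sum_divide_distrib)

lemma pmf_color_pmf:
  assumes "\<And>v c. 0 \<le> Z v c" and pos: "0 < total_weight Z e T"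
  shows "pmf (color_pmf Z e T) c = (if c \<in> T then color_prob Z e T c else 0)"
  unfolding color_pmf_def
proof (rule pmf_embed_pmf)
  have fin: "finite T"
    using pos by (auto simp: total_weight_def intro: ccontr)
  have "(\<integral>\<^sup>+x. ennreal (if x \<in> T then color_prob Z e T x else 0) \<partial>count_space UNIV)
      = (\<integral>\<^sup>+x. ennreal (color_prob Z e T x) * indicator T x \<partial>count_space UNIV)"
    by (intro nn_integral_cong) auto
  also have "\<dots> = (\<Sum>x\<in>T. ennreal (color_prob Z e T x))"
    using fin by (simp add: nn_integral_count_space_indicator[symmetric] nn_integral_count_space_finite)
  also have "\<dots> = ennreal (\<Sum>x\<in>T. color_prob Z e T x)"
    using color_prob_nonneg[OF assms(1)] by (intro sum_ennreal) auto
  finally show "(\<integral>\<^sup>+x. ennreal (if x \<in> T then color_prob Z e T x else 0) \<partial>count_space UNIV) = 1"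
    using sum_color_prob[OF pos] by simp
qed (use color_prob_nonneg[OF assms(1)] in auto)

lemma prob_bind_color_pmf:
  assumes "\<And>v c. 0 \<le> Z v c" and pos: "0 < total_weight Z e T"
  shows "measure_pmf.prob (bind_pmf (color_pmf Z e T) f) X
    = (\<Sum>c\<in>T. color_prob Z e T c * measure_pmf.prob (f c) X)"
proof -
  have fin: "finite T"
    using pos by (auto simp: total_weight_def intro: ccontr)
  have sub: "set_pmf (color_pmf Z e T) \<subseteq> T"
    using pmf_color_pmf[OF assms] by (auto simp: set_pmf_eq)
  have "emeasure (bind_pmf (color_pmf Z e T) f) X
      = (\<integral>\<^sup>+c. ennreal (measure_pmf.prob (f c) X) \<partial>color_pmf Z e T)"
    unfolding emeasure_bind_pmf by (simp add: measure_pmf.emeasure_eq_measure)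
  also have "\<dots> = (\<Sum>c\<in>T. ennreal (measure_pmf.prob (f c) X) * pmf (color_pmf Z e T) c)"
    using sub fin by (intro nn_integral_measure_pmf_support) auto
  also have "\<dots> = (\<Sum>c\<in>T. ennreal (color_prob Z e T c * measure_pmf.prob (f c) X))"
    using color_prob_nonneg[OF assms(1)]
    by (intro sum.cong) (auto simp: pmf_color_pmf[OF assms] ennreal_mult' mult.commute)
  also have "\<dots> = ennreal (\<Sum>c\<in>T. color_prob Z e T c * measure_pmf.prob (f c) X)"
    using color_prob_nonneg[OF assms(1)] by (intro sum_ennreal) auto
  finally show ?thesis
    using color_prob_nonneg[OF assms(1)]
    by (simp add: measure_pmf.emeasure_eq_measure sum_nonneg)
qed

section \<open>Trajectories of the algorithm and validity of its output\<close>

locale edge_sequence =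
  fixes es :: "edge list" and T :: "edge \<Rightarrow> nat set"
  assumes distinct_es: "distinct es"
    and card_edge: "e \<in> set es \<Longrightarrow> card e = 2"
    and finite_T: "e \<in> set es \<Longrightarrow> finite (T e)"
begin

text \<open>\<open>\<kappa> t\<close> is the color of the edge \<open>es ! t\<close>; only the values of \<open>\<kappa>\<close> before \<open>t\<close> matter at time \<open>t\<close>.\<close>

primrec state :: "(nat \<Rightarrow> nat) \<Rightarrow> nat \<Rightarrow> weights" where
  "state \<kappa> 0 = (\<lambda>_ _. 1)"
| "state \<kappa> (Suc t) = update (state \<kappa> t) (es ! t) (T (es ! t)) (\<kappa> t)"

abbreviation prob_at :: "(nat \<Rightarrow> nat) \<Rightarrow> nat \<Rightarrow> nat \<Rightarrow> real" where
  "prob_at \<kappa> t \<equiv> color_prob (state \<kappa> t) (es ! t) (T (es ! t))"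

abbreviation total_at :: "(nat \<Rightarrow> nat) \<Rightarrow> nat \<Rightarrow> real" where
  "total_at \<kappa> t \<equiv> total_weight (state \<kappa> t) (es ! t) (T (es ! t))"

text \<open>Positive weight encodes that the chosen color is still free at both endpoints.\<close>

definition legal :: "(nat \<Rightarrow> nat) \<Rightarrow> nat \<Rightarrow> bool" where
  "legal \<kappa> t \<longleftrightarrow> (\<forall>i<t. \<kappa> i \<in> T (es ! i) \<and> 0 < weight (state \<kappa> i) (es ! i) (\<kappa> i))"

definition hist :: "(edge \<Rightarrow> nat set) \<Rightarrow> (nat \<Rightarrow> nat) \<Rightarrow> nat \<Rightarrow> history" where
  "hist L \<kappa> t = map (\<lambda>i. (es ! i, L (es ! i), \<kappa> i)) [0..<t]"

lemma state_nonneg: "0 \<le> state \<kappa> t v c"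
  by (induction t arbitrary: v c) (auto intro: update_nonneg)

lemma state_cong: "(\<And>i. i < t \<Longrightarrow> \<kappa> i = \<kappa>' i) \<Longrightarrow> state \<kappa> t = state \<kappa>' t"
  by (induction t) auto

lemma state_upd [simp]: "s \<le> t \<Longrightarrow> state (\<kappa>(t := k)) s = state \<kappa> s"
  by (rule state_cong) auto

lemma legal_upd:
  "legal \<kappa> t \<Longrightarrow> k \<in> T (es ! t) \<Longrightarrow> 0 < weight (state \<kappa> t) (es ! t) k
    \<Longrightarrow> legal (\<kappa>(t := k)) (Suc t)"
  by (auto simp: legal_def less_Suc_eq)

lemma hist_upd: "hist L \<kappa> t @ [(es ! t, L (es ! t), k)] = hist L (\<kappa>(t := k)) (Suc t)"
  by (simp add: hist_def)

lemma history_weights_hist: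
  assumes "t \<le> length es" and "\<And>e. e \<in> set es \<Longrightarrow> T e = tr (L e)"
  shows "history_weights tr (hist L \<kappa> t) = state \<kappa> t"
  using assms(1)
proof (induction t)
  case (Suc t)
  have "hist L \<kappa> (Suc t) = hist L \<kappa> t @ [(es ! t, L (es ! t), \<kappa> t)]"
    by (simp add: hist_def)
  with Suc assms(2)[of "es ! t"] show ?case
    by (simp add: history_weights_def)
qed (simp add: history_weights_def hist_def)

lemma state_used_eq_0:
  assumes "i < t" "v \<in> es ! i" "\<kappa> i \<in> T (es ! i)"
  shows "state \<kappa> t v (\<kappa> i) = 0"
  using assms(1)
proof (induction t)
  case (Suc t)
  then show ?case
    using assms(2,3) by (cases "i = t") (auto simp: update_def)
qed simp

lemma coloring_of_hist:
  assumes "i < length es"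
  shows "coloring_of (hist L \<kappa> (length es)) (es ! i) = \<kappa> i"
proof -
  have "map_of (hist L \<kappa> (length es)) (es ! i) = Some (L (es ! i), \<kappa> i)"
  proof (rule map_of_is_SomeI)
    have "map fst (hist L \<kappa> (length es)) = es"
      by (simp add: hist_def comp_def map_nth)
    then show "distinct (map fst (hist L \<kappa> (length es)))"
      using distinct_es by simp
    show "(es ! i, L (es ! i), \<kappa> i) \<in> set (hist L \<kappa> (length es))"
      using assms by (auto simp: hist_def)
  qed
  then show ?thesis by (simp add: coloring_of_def)
qed

text \<open>The earlier of two adjacent edges sets the weight of its color at the common vertex to 0
  for good, so the later one cannot take that color with positive weight.\<close>

lemma legal_imp_valid:
  assumes leg: "legal \<kappa> (length es)" and sub: "\<And>e. e \<in> set es \<Longrightarrow> T e \<subseteq> L e"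
  shows "valid_list_edge_coloring (set es) L (coloring_of (hist L \<kappa> (length es)))"
proof -
  have fin: "finite (es ! i)" if "i < length es" for i
    using card_edge[of "es ! i"] that by (auto intro: card_ge_0_finite)
  have neq: "\<kappa> i \<noteq> \<kappa> j" if ij: "i < j" "j < length es" and v: "v \<in> es ! i" "v \<in> es ! j" for i j v
  proof
    assume eq: "\<kappa> i = \<kappa> j"
    have "state \<kappa> j v (\<kappa> j) = 0"
      using state_used_eq_0[OF ij(1) v(1)] leg ij unfolding legal_def eq[symmetric] by auto
    then have "weight (state \<kappa> j) (es ! j) (\<kappa> j) = 0"
      unfolding weight_def using v fin[OF ij(2)] by (auto simp: prod_zero_iff)
    moreover have "0 < weight (state \<kappa> j) (es ! j) (\<kappa> j)" using leg ij by (auto simp: legal_def)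
    ultimately show False by simp
  qed
  have "coloring_of (hist L \<kappa> (length es)) e \<in> L e" if e: "e \<in> set es" for e
  proof -
    obtain i where i: "i < length es" "e = es ! i" using e by (auto simp: in_set_conv_nth)
    then have "\<kappa> i \<in> T e" using leg by (auto simp: legal_def)
    then show ?thesis using sub[OF e] i by (auto simp: coloring_of_hist)
  qed
  moreover have "coloring_of (hist L \<kappa> (length es)) e \<noteq> coloring_of (hist L \<kappa> (length es)) f"
    if ef: "e \<in> set es" "f \<in> set es" "e \<noteq> f" "e \<inter> f \<noteq> {}" for e f
  proof -
    obtain i j where ij: "i < length es" "e = es ! i" "j < length es" "f = es ! j"
      using ef by (auto simp: in_set_conv_nth)
    obtain v where v: "v \<in> e" "v \<in> f" using ef by auto
    have "i \<noteq> j" using ef ij by auto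
    then show ?thesis
      using neq[of i j v] neq[of j i v] ij v by (cases "i < j") (auto simp: coloring_of_hist)
  qed
  ultimately show ?thesis unfolding valid_list_edge_coloring_def by blast
qed

text \<open>Optional stopping by induction on the number of remaining edges: below 1,
  \<open>\<Psi>\<close> is a supermartingale and the run stays legal; from 1 on, it bounds any
  probability trivially.\<close>

lemma run_failure_le:
  fixes \<Psi> :: "(nat \<Rightarrow> nat) \<Rightarrow> nat \<Rightarrow> real"
  assumes T_eq: "\<And>e. e \<in> set es \<Longrightarrow> T e = tr (L e)"
    and sub: "\<And>e. e \<in> set es \<Longrightarrow> T e \<subseteq> L e"
    and final: "\<And>\<kappa>. Inv \<kappa> (length es) \<Longrightarrow> 0 \<le> \<Psi> \<kappa> (length es)"
    and step: "\<And>\<kappa> t. t < length es \<Longrightarrow> legal \<kappa> t \<Longrightarrow> Inv \<kappa> t \<Longrightarrow> \<Psi> \<kappa> t < 1 \<Longrightarrow>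
      0 < total_at \<kappa> t \<and>
      (\<forall>k\<in>T (es ! t). 0 < weight (state \<kappa> t) (es ! t) k \<longrightarrow> Inv (\<kappa>(t := k)) (Suc t)) \<and>
      (\<Sum>k\<in>T (es ! t). prob_at \<kappa> t k * \<Psi> (\<kappa>(t := k)) (Suc t)) \<le> \<Psi> \<kappa> t"
    and "t \<le> length es" "legal \<kappa> t" "Inv \<kappa> t"
  shows "measure_pmf.prob (run (weight_strategy tr) L (hist L \<kappa> t) (drop t es))
      {h. \<not> valid_list_edge_coloring (set es) L (coloring_of h)} \<le> \<Psi> \<kappa> t"
    (is "measure_pmf.prob _ ?X \<le> _")
  using assms(5-7)
proof (induction "length es - t" arbitrary: t \<kappa>)
  case 0
  then have [simp]: "t = length es" by simp
  have "valid_list_edge_coloring (set es) L (coloring_of (hist L \<kappa> t))"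
    using legal_imp_valid[OF _ sub] 0 by simp
  then show ?case using final 0 by simp
next
  case (Suc x)
  then have t: "t < length es" by simp
  show ?case
  proof (cases "\<Psi> \<kappa> t < 1")
    case False
    then show ?thesis using measure_pmf.prob_le_1 by (meson le_less_linear order_trans)
  next
    case True
    note st = step[OF t Suc.prems(2,3) True]
    have "drop t es = es ! t # drop (Suc t) es" using t by (simp add: Cons_nth_drop_Suc)
    then have "run (weight_strategy tr) L (hist L \<kappa> t) (drop t es)
      = bind_pmf (color_pmf (state \<kappa> t) (es ! t) (T (es ! t)))
         (\<lambda>k. run (weight_strategy tr) L (hist L (\<kappa>(t := k)) (Suc t)) (drop (Suc t) es))"
      using t T_eq[of "es ! t"] history_weights_hist[of t tr L \<kappa>] T_eq
      by (simp add: weight_strategy_def hist_upd)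
    then have "measure_pmf.prob (run (weight_strategy tr) L (hist L \<kappa> t) (drop t es)) ?X
      = (\<Sum>k\<in>T (es ! t). prob_at \<kappa> t k *
          measure_pmf.prob (run (weight_strategy tr) L (hist L (\<kappa>(t := k)) (Suc t)) (drop (Suc t) es)) ?X)"
      using st by (simp only: prob_bind_color_pmf[of "state \<kappa> t", OF state_nonneg])
    also have "\<dots> \<le> (\<Sum>k\<in>T (es ! t). prob_at \<kappa> t k * \<Psi> (\<kappa>(t := k)) (Suc t))"
    proof (rule sum_mono)
      fix k assume k: "k \<in> T (es ! t)"
      show "prob_at \<kappa> t k *
          measure_pmf.prob (run (weight_strategy tr) L (hist L (\<kappa>(t := k)) (Suc t)) (drop (Suc t) es)) ?X
        \<le> prob_at \<kappa> t k * \<Psi> (\<kappa>(t := k)) (Suc t)"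
      proof (cases "0 < weight (state \<kappa> t) (es ! t) k")
        case True
        then have "measure_pmf.prob (run (weight_strategy tr) L (hist L (\<kappa>(t := k)) (Suc t)) (drop (Suc t) es)) ?X
          \<le> \<Psi> (\<kappa>(t := k)) (Suc t)"
          using Suc.hyps t st k legal_upd[OF Suc.prems(2) k True] by auto
        then show ?thesis
          using color_prob_nonneg[of "state \<kappa> t", OF state_nonneg] by (intro mult_left_mono)
      next
        case False
        \<comment> \<open>A color of weight 0 is taken with probability 0, so nothing is claimed
          about \<open>Inv\<close> after it.\<close>
        then have "weight (state \<kappa> t) (es ! t) k = 0"
          using weight_nonneg[of "state \<kappa> t", OF state_nonneg] by (meson antisym not_le)
        then show ?thesis by (simp add: color_prob_def)
      qed
    qed
    also have "\<dots> \<le> \<Psi> \<kappa> t" using st by simp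
    finally show ?thesis .
  qed
qed

end

section \<open>One-step inequalities\<close>

text \<open>Negative dependence: \<open>\<alpha> c\<close> is the mean of a factor that is 1 if
  \<open>c\<close> is drawn and \<open>\<beta> c\<close> otherwise, and only one color is drawn.
  Factors outside \<open>T\<close> are constant.\<close>

lemma one_hot_prod_le:
  fixes P \<alpha> \<beta> :: "nat \<Rightarrow> real"
  assumes "finite D" "finite T" and P: "\<And>c. c \<in> T \<Longrightarrow> 0 \<le> P c" "(\<Sum>c\<in>T. P c) = 1"
    and \<alpha>: "\<And>c. c \<in> D \<Longrightarrow> 0 \<le> \<alpha> c"
    and \<alpha>_eq: "\<And>c. c \<in> D \<Longrightarrow> c \<in> T \<Longrightarrow> \<alpha> c = P c + (1 - P c) * \<beta> c"
    and \<beta>: "\<And>c. c \<in> D \<Longrightarrow> c \<in> T \<Longrightarrow> 0 \<le> \<beta> c" "\<And>c. c \<in> D \<Longrightarrow> c \<in> T \<Longrightarrow> \<beta> c \<le> 1"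
  shows "(\<Sum>k\<in>T. P k * (\<Prod>c\<in>D. if c \<in> T then (if c = k then 1 else \<beta> c) else \<alpha> c)) \<le> (\<Prod>c\<in>D. \<alpha> c)"
  using assms(1) \<alpha> \<alpha>_eq \<beta>
proof (induction D)
  case empty
  then show ?case using P by simp
next
  case (insert x D)
  let ?v = "\<lambda>k c. if c \<in> T then (if c = k then 1 else \<beta> c) else \<alpha> c"
  define F where "F = (\<Sum>k\<in>T. P k * (\<Prod>c\<in>D. ?v k c))"
  have IH: "F \<le> (\<Prod>c\<in>D. \<alpha> c)" unfolding F_def using insert by auto
  have A0: "0 \<le> (\<Prod>c\<in>D. \<alpha> c)" using insert by (auto intro: prod_nonneg)
  show ?case
  proof (cases "x \<in> T")
    case False
    then have "(\<Sum>k\<in>T. P k * (\<Prod>c\<in>insert x D. ?v k c)) = \<alpha> x * F"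
      using insert by (simp add: F_def sum_distrib_left ac_simps)
    then show ?thesis using IH insert by (simp add: mult_left_mono)
  next
    case True
    have le: "\<beta> c \<le> \<alpha> c" if "c \<in> D" "c \<in> T" for c
    proof -
      have "0 \<le> P c * (1 - \<beta> c)" using that insert P by (intro mult_nonneg_nonneg) auto
      moreover have "\<alpha> c = P c + (1 - P c) * \<beta> c" using that insert by auto
      ultimately show ?thesis by (simp add: algebra_simps)
    qed
    \<comment> \<open>If \<open>x\<close> is drawn, every other factor from \<open>T\<close> is at
      its lower value, hence at most its mean.\<close>
    have vx: "(\<Prod>c\<in>D. ?v x c) \<le> (\<Prod>c\<in>D. \<alpha> c)"
      using insert le by (intro prod_mono) auto
    have "(\<Sum>k\<in>T. P k * (\<Prod>c\<in>insert x D. ?v k c))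
      = (\<Sum>k\<in>T. \<beta> x * (P k * (\<Prod>c\<in>D. ?v k c))
           + (if k = x then P x * (1 - \<beta> x) * (\<Prod>c\<in>D. ?v x c) else 0))"
      using insert.hyps True by (intro sum.cong) (auto simp: algebra_simps)
    also have "\<dots> = \<beta> x * F + P x * (1 - \<beta> x) * (\<Prod>c\<in>D. ?v x c)"
      using \<open>finite T\<close> True by (simp add: sum.distrib F_def sum_distrib_left)
    also have "\<dots> \<le> \<beta> x * (\<Prod>c\<in>D. \<alpha> c) + P x * (1 - \<beta> x) * (\<Prod>c\<in>D. \<alpha> c)"
      using IH vx insert.prems P True by (intro add_mono mult_left_mono) auto
    also have "\<dots> = (P x + (1 - P x) * \<beta> x) * (\<Prod>c\<in>D. \<alpha> c)"
      by (simp add: algebra_simps)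
    also have "\<dots> = (\<Prod>c\<in>insert x D. \<alpha> c)"
      using insert.hyps insert.prems(2)[of x] True by simp
    finally show ?thesis .
  qed
qed

section \<open>The function 1 + x - x^2 / 2 under random rescaling\<close>

definition bump :: "real \<Rightarrow> real" where
  "bump x = 1 + x - x\<^sup>2 / 2"

lemma bump_nonneg: "0 \<le> x \<Longrightarrow> x \<le> 1 \<Longrightarrow> 0 \<le> bump x"
  using power_le_one[of x 2] by (simp add: bump_def)

lemma bump_le_exp: "bump x \<le> exp x"
  unfolding bump_def using exp_ge_add_one_self[of x] zero_le_power2[of x] by linarith

lemma exp_le_bump:
  assumes "0 \<le> x" "x \<le> 1/2"
  shows "exp (x - 2 * x\<^sup>2) \<le> bump x"
proof -
  define y where "y = x - 2 * x\<^sup>2"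
  have y: "y = x * (1 - 2 * x)" by (simp add: y_def power2_eq_square algebra_simps)
  have "0 \<le> y" unfolding y using assms by (intro mult_nonneg_nonneg) auto
  moreover have "y \<le> x" by (simp add: y_def)
  moreover have "y\<^sup>2 \<le> x\<^sup>2" using calculation by (intro power_mono) auto
  ultimately have "exp y \<le> 1 + y + x\<^sup>2" using exp_bound[of y] assms by linarith
  then show ?thesis unfolding y_def by (simp add: bump_def) (use zero_le_power2[of x] in linarith)
qed

text \<open>Replacing \<open>x\<close> by 0 with probability \<open>p\<close> and by
  \<open>x / (1 - p)\<close> otherwise keeps the linear term and only enlarges the negative
  quadratic one.\<close>

lemma bump_mean_le:
  assumes "0 \<le> p" "p < 1"
  shows "p + (1 - p) * bump (x / (1 - p)) \<le> bump x"
proof -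
  have "(1 - p) * bump (x / (1 - p)) = (1 - p) + x - x\<^sup>2 / (2 * (1 - p))"
  proof -
    have "(1 - p) * (x / (1 - p)) = x" "(1 - p) * ((x / (1 - p))\<^sup>2 / 2) = x\<^sup>2 / (2 * (1 - p))"
      using assms by (auto simp: power2_eq_square)
    then show ?thesis by (simp only: bump_def ring_distribs mult_1_right)
  qed
  moreover have "x\<^sup>2 / 2 \<le> x\<^sup>2 / (2 * (1 - p))"
    using assms by (intro divide_left_mono) auto
  ultimately show ?thesis by (simp add: bump_def)
qed

text \<open>The case of two weights that are killed together. The gain in the mixed term
  \<open>x * y\<close> is at most the gain in the two negative quadratic terms.\<close>

lemma bump_pair_mean_le:
  assumes p: "0 \<le> p" "p < 1" and xy: "0 \<le> x" "0 \<le> y" "x \<le> 1 - p" "y \<le> 1 - p"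
  shows "p + (1 - p) * (bump (x / (1 - p)) * bump (y / (1 - p))) \<le> bump x * bump y"
proof -
  define r where "r = 1 / (1 - p)"
  have r: "1 \<le> r" "(1 - p) * r = 1" using p by (auto simp: r_def)
  have xr: "x * r \<le> 1" "y * r \<le> 1" using xy p by (auto simp: r_def field_simps)
  have rx: "x \<le> x * r" "y \<le> y * r" using r xy by (auto simp: mult_le_cancel_left1)
  \<comment> \<open>From \<open>bump x = 1 + x * (1 - x / 2)\<close>: after rescaling, the product
    of the two nonconstant parts is \<open>r^2 * x * y * k\<close>.\<close>
  define k where "k = (1 - x * r / 2) * (1 - y * r / 2)"
  have k: "0 \<le> k" "k \<le> 1" "k \<le> (1 - x / 2) * (1 - y / 2)"
    unfolding k_def using xr xy rx r
    by (auto intro!: mult_nonneg_nonneg mult_le_one mult_mono)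
  have bx: "(1 - p) * (bump (x * r) * bump (y * r)) = (1 - p) + (x + y) - r * ((x\<^sup>2 + y\<^sup>2) / 2) + r * (x * y * k)"
  proof -
    have "bump (x * r) * bump (y * r) = 1 + r * (x + y) - r\<^sup>2 * ((x\<^sup>2 + y\<^sup>2) / 2) + r\<^sup>2 * (x * y * k)"
      unfolding bump_def k_def by (simp add: power2_eq_square field_simps)
    then have "(1 - p) * (bump (x * r) * bump (y * r)) = (1 - p) + ((1 - p) * r) * (x + y)
        - ((1 - p) * r) * r * ((x\<^sup>2 + y\<^sup>2) / 2) + ((1 - p) * r) * r * (x * y * k)"
      by (simp only: power2_eq_square ring_distribs mult.assoc mult_1_right)
    then show ?thesis by (simp only: r mult_1_left)
  qed
  have "(r - 1) * (x * y * k) \<le> (r - 1) * ((x\<^sup>2 + y\<^sup>2) / 2)"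
  proof (intro mult_left_mono)
    have "x * y * k \<le> x * y" using k xy by (simp add: mult_left_le)
    also have "\<dots> \<le> (x\<^sup>2 + y\<^sup>2) / 2" using sum_squares_bound[of x y] by simp
    finally show "x * y * k \<le> (x\<^sup>2 + y\<^sup>2) / 2" .
  qed (use r in simp)
  moreover have "x * y * k \<le> x * y * ((1 - x / 2) * (1 - y / 2))"
    using k xy by (intro mult_left_mono) auto
  moreover have "bump x * bump y = 1 + (x + y) - (x\<^sup>2 + y\<^sup>2) / 2 + x * y * ((1 - x / 2) * (1 - y / 2))"
    unfolding bump_def by (simp add: power2_eq_square field_simps)
  moreover have "bump (x / (1 - p)) * bump (y / (1 - p)) = bump (x * r) * bump (y * r)"
    by (simp add: r_def)
  ultimately have "p + ((1 - p) + (x + y) - r * ((x\<^sup>2 + y\<^sup>2) / 2) + r * (x * y * k)) \<le> bump x * bump y"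
    unfolding left_diff_distrib mult_1_left by linarith
  then have "p + (1 - p) * (bump (x * r) * bump (y * r)) \<le> bump x * bump y"
    by (simp only: bx)
  then show ?thesis by (simp add: r_def)
qed

lemma exp_le_one_minus:
  fixes x :: real
  assumes "0 \<le> x" "x \<le> 1/2"
  shows "exp (- x - 2 * x\<^sup>2) \<le> 1 - x"
  using ln_one_minus_pos_lower_bound[OF assms] assms by (simp add: ln_ge_iff)

section \<open>Weights below their caps\<close>

definition other :: "edge \<Rightarrow> nat \<Rightarrow> nat" where
  "other e v = the_elem (e - {v})"

lemma edge_eq_other:
  assumes "card e = 2" "v \<in> e"
  shows "e = {v, other e v}" "other e v \<noteq> v"
proof -
  obtain x y where xy: "e = {x, y}" "x \<noteq> y" using assms(1) by (auto simp: card_2_iff)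
  then have "e - {v} = {if v = x then y else x}" using assms(2) by auto
  then have "other e v = (if v = x then y else x)" by (simp add: other_def)
  then show "e = {v, other e v}" "other e v \<noteq> v" using xy assms(2) by auto
qed

lemma weight_other:
  "card e = 2 \<Longrightarrow> v \<in> e \<Longrightarrow> weight Z e c = Z v c * Z (other e v) c"
proof -
  assume "card e = 2" "v \<in> e"
  note e = edge_eq_other[OF this]
  have "weight Z {v, other e v} c = Z v c * Z (other e v) c"
    using e(2) by (simp add: weight_def)
  then show ?thesis by (simp only: e(1)[symmetric])
qed

text \<open>Here \<open>q\<close> is a real number, the slack of the lists over the degree, and each
  bad event will have probability at most \<open>exp (- l)\<close>. The cubic condition states that
  \<open>q\<close> is at least of order N^(2/3) l^(1/3).\<close>

locale capped_coloring = edge_sequence +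
  fixes N \<Delta> :: nat and q l :: real
  assumes card_T: "e \<in> set es \<Longrightarrow> card (T e) = N"
    and degree_le: "card {i. i < length es \<and> v \<in> es ! i} \<le> \<Delta>"
    and q_pos: "0 < q" and N_ge: "real \<Delta> + q \<le> real N"
    and l_ge: "1 \<le> l" and q_cube: "8192 * (real N)\<^sup>2 * l \<le> q ^ 3"
begin

abbreviation m :: nat where "m \<equiv> length es"

definition V :: "nat set" where "V = \<Union> (set es)"

definition C :: "nat set" where "C = \<Union> (T ` set es)"

definition deg :: "nat \<Rightarrow> nat \<Rightarrow> nat" where
  "deg v t = card {i. i < t \<and> v \<in> es ! i}"

text \<open>Twice the weight expected of a free color: the reciprocal weight should be near
  \<open>1 - deg v t / N\<close>, and the cap allows it to fall to half of that.\<close>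

definition cap :: "nat \<Rightarrow> nat \<Rightarrow> real" where
  "cap v t = 2 * N / (real N - deg v t)"

definition B :: real where "B = 2 * N / q"

definition wcap :: "nat \<Rightarrow> real" where
  "wcap j = (\<Prod>v\<in>es ! j. cap v j)"

text \<open>The relative error allowed in a total weight, chosen so that
  \<open>lam j * N * dev j / 2\<close> equals \<open>l\<close>.\<close>

definition dev :: "nat \<Rightarrow> real" where
  "dev j = sqrt (8 * l * wcap j / N)"

text \<open>The exponential-moment parameter for total weights. The 4 leaves room for weights up to
  \<open>4 * wcap j\<close>, which can occur at the moment of a first violation.\<close>

definition lam :: "nat \<Rightarrow> real" where
  "lam j = dev j / (4 * wcap j)"

text \<open>An upper bound for \<open>1 / (1 - dev j)\<close>, the loss from replacing a total
  weight by \<open>N\<close>.\<close>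

definition coef :: "nat \<Rightarrow> real" where
  "coef j = 1 + 2 * dev j"

text \<open>The exponential-moment parameter for neighbour sums. Since
  \<open>eta * B = q / (32 * N)\<close>, the second-order loss costs at most \<open>q / 8\<close> of
  the slack.\<close>

definition eta :: real where "eta = q / (32 * B * N)"

lemma es_nth: "t < m \<Longrightarrow> card (es ! t) = 2" "t < m \<Longrightarrow> finite (T (es ! t))"
    "t < m \<Longrightarrow> card (T (es ! t)) = N" "t < m \<Longrightarrow> v \<in> es ! t \<Longrightarrow> v \<in> V"
    "t < m \<Longrightarrow> c \<in> T (es ! t) \<Longrightarrow> c \<in> C"
  using card_edge finite_T card_T by (auto simp: V_def C_def)

lemma finite_V: "finite V"
proof -
  have "finite e" if "e \<in> set es" for e using card_edge[OF that] by (intro card_ge_0_finite) simp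
  then show ?thesis by (auto simp: V_def)
qed

lemma finite_C: "finite C"
  unfolding C_def using finite_T by auto

lemma N_q: "0 < real N" "q \<le> real N" "0 < N"
  using q_pos N_ge by (auto simp: of_nat_0_less_iff[symmetric] simp del: of_nat_0_less_iff)

lemma deg_mono: "s \<le> t \<Longrightarrow> deg v s \<le> deg v t"
  unfolding deg_def by (rule card_mono) auto

lemma deg_Suc: "deg v (Suc t) = deg v t + (if v \<in> es ! t then 1 else 0)"
proof -
  have "{i. i < Suc t \<and> v \<in> es ! i} = {i. i < t \<and> v \<in> es ! i} \<union> (if v \<in> es ! t then {t} else {})"
    by (auto simp: less_Suc_eq)
  then show ?thesis by (auto simp: deg_def)
qed

lemma deg_le: "t \<le> m \<Longrightarrow> real (deg v t) \<le> real N - q"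
  using deg_mono[of t m v] degree_le[of v] N_ge by (simp add: deg_def)

lemma cap_bounds:
  assumes "t \<le> m"
  shows "2 \<le> cap v t" "cap v t \<le> B"
proof -
  have d: "q \<le> real N - deg v t" using deg_le[OF assms, of v] by simp
  then show "cap v t \<le> B" unfolding cap_def B_def using q_pos N_q by (intro divide_left_mono) auto
  have "2 * (real N - deg v t) \<le> 2 * N" by simp
  then show "2 \<le> cap v t" unfolding cap_def using d q_pos by (subst le_divide_eq) auto
qed

lemma cap_mono:
  assumes "s \<le> t" "t \<le> m"
  shows "cap v s \<le> cap v t"
  using deg_le[OF assms(2), of v] deg_mono[OF assms(1), of v] q_pos N_q
  by (auto simp: cap_def intro!: divide_left_mono mult_pos_pos)

lemma B_pos: "0 < B" using q_pos N_q by (simp add: B_def)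

lemma wcap_eq: "t < m \<Longrightarrow> v \<in> es ! t \<Longrightarrow> wcap t = cap v t * cap (other (es ! t) v) t"
  using weight_other[of "es ! t" v "\<lambda>v _. cap v t" 0] es_nth by (simp add: wcap_def weight_def)

lemma edge_obtain:
  assumes "t < m" obtains x where "x \<in> es ! t"
  using es_nth(1)[OF assms] by (metis card.empty all_not_in_conv zero_neq_numeral)

lemma wcap_bounds:
  assumes "t < m"
  shows "1 \<le> wcap t" "wcap t \<le> B\<^sup>2" "v \<in> es ! t \<Longrightarrow> wcap t \<le> cap v t * B"
proof -
  have *: "1 \<le> wcap t \<and> wcap t \<le> cap v t * B" if "v \<in> es ! t" for v
    using cap_bounds[of t v] cap_bounds[of t "other (es ! t) v"] assms that
    by (auto simp: wcap_eq intro!: mult_left_mono mult_ge1_I)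
  obtain x where x: "x \<in> es ! t" using edge_obtain[OF assms] .
  have "cap x t * B \<le> B * B" using cap_bounds[of t x] assms B_pos by (intro mult_right_mono) auto
  then show "1 \<le> wcap t" "wcap t \<le> B\<^sup>2" "v \<in> es ! t \<Longrightarrow> wcap t \<le> cap v t * B"
    using *[OF x] * by (auto simp: power2_eq_square)
qed

lemma q_sq: "8192 * real N * l \<le> q\<^sup>2" "8192 * real N \<le> q\<^sup>2"
proof -
  have "(8192 * real N * l) * N \<le> q\<^sup>2 * q"
    using q_cube by (simp add: power2_eq_square power3_eq_cube ac_simps)
  also have "\<dots> \<le> q\<^sup>2 * N" using N_q by (intro mult_left_mono) auto
  finally show *: "8192 * real N * l \<le> q\<^sup>2" using N_q by (metis mult_le_cancel_right_pos)
  have "8192 * real N * 1 \<le> 8192 * real N * l" using l_ge by (intro mult_left_mono) auto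
  with * show "8192 * real N \<le> q\<^sup>2" by simp
qed

text \<open>Products of two caps stay far below \<open>N\<close>, so no single color dominates a
  total weight, even after multiplication by \<open>l\<close>.\<close>

lemma B_sq: "B\<^sup>2 \<le> N / 2048" "l * B\<^sup>2 \<le> N / 2048"
proof -
  have e: "B\<^sup>2 * q\<^sup>2 = 4 * real N * real N" using q_pos by (simp add: B_def power2_eq_square)
  have "B\<^sup>2 * (8192 * real N) \<le> 4 * real N * real N" "(l * B\<^sup>2) * (8192 * real N) \<le> 4 * real N * real N"
    using mult_left_mono[OF q_sq(2), of "B\<^sup>2"] mult_left_mono[OF q_sq(1), of "B\<^sup>2"] e by (simp_all add: ac_simps)
  then show "B\<^sup>2 \<le> N / 2048" "l * B\<^sup>2 \<le> N / 2048"
    using N_q by simp_all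
qed

lemma dev_sq: "t < m \<Longrightarrow> (dev t)\<^sup>2 = 8 * l * wcap t / N"
  using wcap_bounds[of t] l_ge by (simp add: dev_def)

lemma dev_bounds:
  assumes "t < m"
  shows "0 < dev t" "dev t \<le> 1/2"
proof -
  show "0 < dev t" using wcap_bounds[OF assms] l_ge N_q by (simp add: dev_def)
  have "l * wcap t \<le> l * B\<^sup>2" using wcap_bounds[OF assms] l_ge by (intro mult_left_mono) auto
  also have "\<dots> \<le> N / 2048" by (rule B_sq)
  finally have "8 * l * wcap t / N \<le> (1/2)\<^sup>2" using N_q by (simp add: field_simps power2_eq_square)
  then show "dev t \<le> 1/2" unfolding dev_def by (intro real_le_lsqrt) auto
qed

lemma coef_bounds: "t < m \<Longrightarrow> 1 \<le> coef t" "t < m \<Longrightarrow> coef t \<le> 2"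
  using dev_bounds[of t] by (auto simp: coef_def)

lemma eta_bounds: "0 < eta" "eta * B = q / (32 * N)" "eta * B \<le> 1 / 32"
  using q_pos N_q B_pos by (auto simp: eta_def)

text \<open>At time \<open>m\<close> no edge arrives, so only the caps are required then.\<close>

definition good :: "(nat \<Rightarrow> nat) \<Rightarrow> nat \<Rightarrow> bool" where
  "good \<kappa> t \<longleftrightarrow> (\<forall>v\<in>V. \<forall>c\<in>C. state \<kappa> t v c \<le> cap v t) \<and>
     (t < m \<longrightarrow> real N * (1 - dev t) \<le> total_at \<kappa> t)"

definition all_good :: "(nat \<Rightarrow> nat) \<Rightarrow> nat \<Rightarrow> bool" where
  "all_good \<kappa> t \<longleftrightarrow> (\<forall>i<t. good \<kappa> i)"

lemma good_total:
  assumes "t < m" "good \<kappa> t"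
  shows "real N / 2 \<le> total_at \<kappa> t" "0 < total_at \<kappa> t"
proof -
  have "real N * (1/2) \<le> real N * (1 - dev t)"
    using dev_bounds[OF assms(1)] by (intro mult_left_mono) auto
  also have "\<dots> \<le> total_at \<kappa> t" using assms by (simp add: good_def)
  finally show "real N / 2 \<le> total_at \<kappa> t" by simp
  then show "0 < total_at \<kappa> t" using N_q by linarith
qed

lemma good_weight_le:
  assumes "s \<le> t" "t < m" "good \<kappa> s" "c \<in> C"
  shows "weight (state \<kappa> s) (es ! t) c \<le> wcap t"
proof -
  have "state \<kappa> s v c \<le> cap v t" if "v \<in> es ! t" for v
    using assms es_nth(4)[OF assms(2) that] cap_mono[of s t v] unfolding good_def by (meson less_imp_le order_trans)
  then show ?thesis unfolding weight_def wcap_def by (intro prod_mono) (auto simp: state_nonneg)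
qed

lemma good_prob_le:
  assumes "t < m" "good \<kappa> t" "c \<in> T (es ! t)"
  shows "prob_at \<kappa> t c \<le> 1/2"
proof -
  have "weight (state \<kappa> t) (es ! t) c \<le> wcap t"
    using assms es_nth(5) by (intro good_weight_le) auto
  also have "\<dots> \<le> N / 4" using wcap_bounds[OF assms(1)] B_sq N_q by linarith
  also have "\<dots> \<le> total_at \<kappa> t / 2" using good_total[OF assms(1,2)] by simp
  finally show ?thesis using good_total[OF assms(1,2)] by (simp add: color_prob_def field_simps)
qed

lemma state_Suc_le:
  assumes "t < m" "good \<kappa> t"
  shows "state \<kappa> (Suc t) v c \<le> 2 * state \<kappa> t v c"
proof -
  have "state \<kappa> t v c / (1 - prob_at \<kappa> t c) \<le> 2 * state \<kappa> t v c" if "c \<in> T (es ! t)"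
  proof -
    have "state \<kappa> t v c * 1 \<le> state \<kappa> t v c * (2 * (1 - prob_at \<kappa> t c))"
      using good_prob_le[OF assms that] state_nonneg by (intro mult_left_mono) auto
    then show ?thesis using good_prob_le[OF assms that] by (simp add: divide_le_eq algebra_simps)
  qed
  then show ?thesis using state_nonneg[of \<kappa> t v c] by (auto simp: update_def)
qed

text \<open>A good step at most doubles a weight. Thus even at a first violation the caps are
  exceeded by at most a factor 2, and the potentials remain nonnegative there.\<close>

lemma state_le:
  assumes "t \<le> m" "all_good \<kappa> t" "v \<in> V" "c \<in> C"
  shows "state \<kappa> t v c \<le> 2 * cap v t"
proof (cases t)
  case 0
  then show ?thesis using cap_bounds[of t v] assms(1) by simp
next
  case (Suc s)
  then have s: "s < m" "good \<kappa> s" using assms by (auto simp: all_good_def)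
  have "state \<kappa> t v c \<le> 2 * state \<kappa> s v c" using state_Suc_le[OF s] Suc by simp
  also have "\<dots> \<le> 2 * cap v s" using s assms by (auto simp: good_def)
  also have "\<dots> \<le> 2 * cap v t" using cap_mono[of s t v] Suc assms by simp
  finally show ?thesis .
qed

definition idx :: "nat \<Rightarrow> nat \<Rightarrow> nat \<Rightarrow> nat set" where
  "idx v c j = {i. i < j \<and> v \<in> es ! i \<and> c \<in> T (es ! i)}"

lemma finite_idx [simp]: "finite (idx v c j)" by (simp add: idx_def)

lemma idxD:
  assumes "i \<in> idx v c j" "j \<le> m"
  shows "i < j" "i < m" "v \<in> es ! i" "c \<in> T (es ! i)" "other (es ! i) v \<in> es ! i"
    "other (es ! i) v \<in> V" "c \<in> C"
proof -
  show i: "i < j" "v \<in> es ! i" "c \<in> T (es ! i)" using assms(1) by (auto simp: idx_def)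
  then show m: "i < m" using assms(2) by simp
  show o: "other (es ! i) v \<in> es ! i" using edge_eq_other(1)[OF es_nth(1)[OF m] i(2)] by blast
  show "other (es ! i) v \<in> V" "c \<in> C" using es_nth(4)[OF m o] es_nth(5)[OF m i(3)] by auto
qed

text \<open>While color \<open>c\<close> is free at \<open>v\<close>, each step at \<open>v\<close> lowers the reciprocal weight by an
  amount that depends on the other endpoint only.\<close>

lemma inverse_state:
  assumes "t \<le> m" "all_good \<kappa> t" "state \<kappa> t v c \<noteq> 0"
  shows "1 / state \<kappa> t v c = 1 - (\<Sum>i\<in>idx v c t. state \<kappa> i (other (es ! i) v) c / total_at \<kappa> i)"
  using assms
proof (induction t)
  case 0
  then show ?case by (simp add: idx_def)
next
  case (Suc t)
  then have t: "t < m" "good \<kappa> t" "all_good \<kappa> t" by (auto simp: all_good_def)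
  show ?case
  proof (cases "v \<in> es ! t \<and> c \<in> T (es ! t)")
    case False
    then have "idx v c (Suc t) = idx v c t" by (auto simp: idx_def less_Suc_eq)
    moreover have "state \<kappa> (Suc t) v c = state \<kappa> t v c" using False by (auto simp: update_def)
    ultimately show ?thesis using Suc t by simp
  next
    case True
    let ?P = "prob_at \<kappa> t c"
    have idx: "idx v c (Suc t) = insert t (idx v c t)" "t \<notin> idx v c t"
      using True by (auto simp: idx_def less_Suc_eq)
    have st: "state \<kappa> (Suc t) v c = state \<kappa> t v c / (1 - ?P)" "state \<kappa> t v c \<noteq> 0"
      using True Suc.prems(3) by (auto simp: update_def split: if_splits)
    \<comment> \<open>The weight at \<open>v\<close> is a factor of the color probability and
      cancels.\<close>
    have "?P / state \<kappa> t v c = state \<kappa> t (other (es ! t) v) c / total_at \<kappa> t"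
      using st(2) True t es_nth(1) by (simp add: color_prob_def weight_other[of _ v])
    then have "1 / state \<kappa> (Suc t) v c = 1 / state \<kappa> t v c - state \<kappa> t (other (es ! t) v) c / total_at \<kappa> t"
      using st by (simp add: diff_divide_distrib)
    then show ?thesis using Suc.IH t st(2) idx by simp
  qed
qed

end

section \<open>Supermartingales\<close>

context capped_coloring
begin

definition Phi :: "nat \<Rightarrow> (nat \<Rightarrow> nat) \<Rightarrow> nat \<Rightarrow> real" where
  "Phi j \<kappa> t = (\<Prod>c\<in>T (es ! j). 1 - lam j * weight (state \<kappa> t) (es ! j) c)"

text \<open>The exponent lies between \<open>lam j * N\<close>, attained at weight 1, and
  \<open>lam j * N * (1 - dev j)\<close>, the value at the allowed deviation; the other half of the
  gap covers second-order terms.\<close>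

definition Phi_thr :: "nat \<Rightarrow> real" where
  "Phi_thr j = exp (- (lam j * N * (1 - dev j / 2)))"

text \<open>The weights at the other endpoint of \<open>es ! i\<close> are frozen when \<open>es ! i\<close> arrives, as these are the
  values that enter \<open>inverse_state\<close>; hence \<open>min t i\<close>.\<close>

definition Xi :: "nat \<Rightarrow> nat \<Rightarrow> nat \<Rightarrow> (nat \<Rightarrow> nat) \<Rightarrow> nat \<Rightarrow> real" where
  "Xi v c j \<kappa> t = (\<Prod>i\<in>idx v c j. bump (eta * coef i * state \<kappa> (min t i) (other (es ! i) v) c))"

text \<open>Here \<open>(N + deg v j) / 2\<close> is \<open>N * (1 - 1 / cap v j)\<close>, the size
  of the neighbour sum at which the cap is reached. The factor \<open>1 - 4 * eta * B\<close>
  absorbs the gap between \<open>bump\<close> and \<open>exp\<close>.\<close>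

definition Xi_thr :: "nat \<Rightarrow> nat \<Rightarrow> real" where
  "Xi_thr v j = exp (eta * (1 - 4 * eta * B) * ((N + deg v j) / 2))"

lemma lam_bounds:
  assumes "j < m"
  shows "0 < lam j" "lam j * wcap j = dev j / 4"
  using dev_bounds[OF assms] wcap_bounds[OF assms] by (auto simp: lam_def)

section \<open>Lower tails of total weights\<close>

lemma state_Suc_disjoint:
  "v \<notin> es ! t \<or> c \<notin> T (es ! t) \<Longrightarrow> state \<kappa> (Suc t) v c = state \<kappa> t v c"
  by (auto simp: update_def)

lemma edges_inter:
  assumes "t < m" "j < m" "t \<noteq> j" "x \<in> es ! t" "x \<in> es ! j"
  shows "other (es ! j) x \<notin> es ! t"
proof
  assume o: "other (es ! j) x \<in> es ! t"
  note e = edge_eq_other[OF es_nth(1)[OF assms(2)] assms(5)]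
  have sub: "es ! j \<subseteq> es ! t" using o assms(4) e(1) by auto
  have "es ! j = es ! t"
    using card_subset_eq[OF _ sub] es_nth(1)[OF assms(1)] es_nth(1)[OF assms(2)]
    by (metis card.infinite zero_neq_numeral)
  then show False using assms distinct_es by (simp add: nth_eq_iff_index_eq)
qed

text \<open>The arriving edge meets \<open>es ! j\<close> in at most one vertex, so each affected
  product weight is either killed or divided by \<open>1 - P\<close>. This is the one-hot
  situation.\<close>

lemma Phi_step:
  assumes t: "t < j" "j < m" and g: "good \<kappa> t"
  shows "(\<Sum>k\<in>T (es ! t). prob_at \<kappa> t k * Phi j (\<kappa>(t := k)) (Suc t)) \<le> Phi j \<kappa> t"
proof -
  have tm: "t < m" using t by simp
  have pos: "0 < total_at \<kappa> t" using good_total[OF tm g] by simp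
  have sum1: "(\<Sum>k\<in>T (es ! t). prob_at \<kappa> t k) = 1" by (rule sum_color_prob[OF pos])
  show ?thesis
  proof (cases "es ! t \<inter> es ! j = {}")
    case True
    have "Phi j (\<kappa>(t := k)) (Suc t) = Phi j \<kappa> t" for k
    proof -
      have "weight (state (\<kappa>(t := k)) (Suc t)) (es ! j) c = weight (state \<kappa> t) (es ! j) c" for c
        unfolding weight_def using True by (intro prod.cong refl) (subst state_Suc_disjoint, auto)
      then show ?thesis by (simp add: Phi_def del: state.simps)
    qed
    then show ?thesis using sum1 by (simp flip: sum_distrib_right)
  next
    case False
    then obtain x where x: "x \<in> es ! t" "x \<in> es ! j" by auto
    have y: "other (es ! j) x \<notin> es ! t" using edges_inter[OF tm t(2) _ x] t by simp
    define w where "w c = weight (state \<kappa> t) (es ! j) c" for c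
    define \<beta> where "\<beta> c = 1 - lam j * (w c / (1 - prob_at \<kappa> t c))" for c
    have w0: "0 \<le> w c" for c unfolding w_def by (intro weight_nonneg state_nonneg)
    have w: "lam j * w c \<le> 1/8" if "c \<in> T (es ! j)" for c
    proof -
      have "lam j * w c \<le> lam j * wcap j"
        using lam_bounds[OF t(2)] good_weight_le[of t j \<kappa> c] t g es_nth(5)[OF t(2) that]
        unfolding w_def by (intro mult_left_mono) auto
      then show ?thesis using lam_bounds[OF t(2)] dev_bounds[OF t(2)] by simp
    qed
    have eq: "1 - lam j * weight (state (\<kappa>(t := k)) (Suc t)) (es ! j) c
      = (if c \<in> T (es ! t) then (if c = k then 1 else \<beta> c) else 1 - lam j * w c)" for c k
      using x y by (simp add: weight_other[OF es_nth(1)[OF t(2)] x(2)] update_def \<beta>_def w_def)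
    have "(\<Sum>k\<in>T (es ! t). prob_at \<kappa> t k * (\<Prod>c\<in>T (es ! j). if c \<in> T (es ! t) then (if c = k then 1 else \<beta> c) else 1 - lam j * w c))
      \<le> (\<Prod>c\<in>T (es ! j). 1 - lam j * w c)"
    proof (rule one_hot_prod_le)
      show "finite (T (es ! j))" "finite (T (es ! t))" using es_nth(2) t by auto
      show "0 \<le> prob_at \<kappa> t c" for c by (intro color_prob_nonneg state_nonneg)
      show "0 \<le> 1 - lam j * w c" if "c \<in> T (es ! j)" for c using w[OF that] by simp
      fix c assume c: "c \<in> T (es ! j)" "c \<in> T (es ! t)"
      have P: "prob_at \<kappa> t c \<le> 1/2" by (rule good_prob_le[OF tm g c(2)])
      then show "1 - lam j * w c = prob_at \<kappa> t c + (1 - prob_at \<kappa> t c) * \<beta> c"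
        by (simp add: \<beta>_def field_simps)
      show "\<beta> c \<le> 1" using P w0 lam_bounds[OF t(2)] by (simp add: \<beta>_def)
      have "lam j * w c / (1 - prob_at \<kappa> t c) \<le> 1"
        using P w[OF c(1)] by (subst divide_le_eq) auto
      then show "0 \<le> \<beta> c" by (simp add: \<beta>_def)
    qed (use sum1 in simp)
    then show ?thesis unfolding Phi_def eq w_def .
  qed
qed

text \<open>With every endpoint weight at most twice its cap, \<open>lam j\<close> times the product
  weight is at most \<open>lam j * 4 * wcap j = dev j\<close>, hence below 1.\<close>

lemma Phi_nonneg:
  assumes "t \<le> j" "j < m" "all_good \<kappa> t"
  shows "0 \<le> Phi j \<kappa> t"
  unfolding Phi_def
proof (rule prod_nonneg)
  fix c assume c: "c \<in> T (es ! j)"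
  have "weight (state \<kappa> t) (es ! j) c \<le> (\<Prod>v\<in>es ! j. 2 * cap v j)"
    unfolding weight_def
  proof (intro prod_mono conjI state_nonneg)
    fix v assume v: "v \<in> es ! j"
    have "state \<kappa> t v c \<le> 2 * cap v t"
      using assms v c es_nth(4,5)[OF assms(2)] by (intro state_le) auto
    also have "\<dots> \<le> 2 * cap v j" using cap_mono[of t j v] assms by simp
    finally show "state \<kappa> t v c \<le> 2 * cap v j" .
  qed
  also have "\<dots> = 4 * wcap j" using es_nth(1)[OF assms(2)] by (simp add: prod.distrib wcap_def)
  finally have "lam j * weight (state \<kappa> t) (es ! j) c \<le> lam j * (4 * wcap j)"
    using lam_bounds[OF assms(2)] by (intro mult_left_mono) auto
  also have "\<dots> = dev j" using lam_bounds[OF assms(2)] by simp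
  finally show "0 \<le> 1 - lam j * weight (state \<kappa> t) (es ! j) c"
    using dev_bounds[OF assms(2)] by linarith
qed

text \<open>Under the caps each factor is close to an exponential, so the product is essentially
  \<open>exp (- lam t * total_at \<kappa> t)\<close>, which a small total weight makes
  large.\<close>

lemma Phi_bad:
  assumes t: "t < m" and le: "\<And>v c. v \<in> V \<Longrightarrow> c \<in> C \<Longrightarrow> state \<kappa> t v c \<le> cap v t"
    and bad: "total_at \<kappa> t < real N * (1 - dev t)"
  shows "Phi_thr t \<le> Phi t \<kappa> t"
proof -
  let ?w = "\<lambda>c. weight (state \<kappa> t) (es ! t) c"
  note lb = lam_bounds[OF t] and db = dev_bounds[OF t]
  have w: "0 \<le> ?w c" "?w c \<le> wcap t" if "c \<in> T (es ! t)" for c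
    using le es_nth(4,5)[OF t] that
    by (auto simp: weight_def wcap_def state_nonneg intro!: prod_mono prod_nonneg)
  have ge: "exp (- (lam t * (1 + dev t / 2)) * ?w c) \<le> 1 - lam t * ?w c" if c: "c \<in> T (es ! t)" for c
  proof -
    define x where "x = lam t * ?w c"
    have "x \<le> lam t * wcap t" unfolding x_def using w[OF c] lb by (intro mult_left_mono) auto
    then have x: "0 \<le> x" "x \<le> dev t / 4" using w[OF c] lb by (auto simp: x_def)
    have "x * x \<le> x * (dev t / 4)" using x by (intro mult_left_mono) auto
    then have "- (x * (1 + dev t / 2)) \<le> - x - 2 * x\<^sup>2" by (simp add: power2_eq_square algebra_simps)
    then have "exp (- (x * (1 + dev t / 2))) \<le> exp (- x - 2 * x\<^sup>2)" by simp
    also have "\<dots> \<le> 1 - x" using x db by (intro exp_le_one_minus) auto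
    finally show ?thesis by (simp add: x_def ac_simps)
  qed
  \<comment> \<open>The second-order correction \<open>1 + dev t / 2\<close> uses up only half of
    the deviation.\<close>
  have "(1 - dev t) * (1 + dev t / 2) \<le> 1 - dev t / 2"
    using db by (simp add: algebra_simps)
  then have "lam t * N * ((1 - dev t) * (1 + dev t / 2)) \<le> lam t * N * (1 - dev t / 2)"
    using lb by (intro mult_left_mono) auto
  moreover have "lam t * (1 + dev t / 2) * total_at \<kappa> t \<le> lam t * (1 + dev t / 2) * (N * (1 - dev t))"
    using bad lb db by (intro mult_left_mono) auto
  ultimately have "lam t * (1 + dev t / 2) * total_at \<kappa> t \<le> lam t * N * (1 - dev t / 2)"
    by (simp add: ac_simps)
  then have "Phi_thr t \<le> exp (- (lam t * (1 + dev t / 2)) * total_at \<kappa> t)"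
    by (simp add: Phi_thr_def)
  also have "\<dots> = (\<Prod>c\<in>T (es ! t). exp (- (lam t * (1 + dev t / 2)) * ?w c))"
    using es_nth(2)[OF t] by (simp only: total_weight_def sum_distrib_left exp_sum)
  also have "\<dots> \<le> Phi t \<kappa> t"
    unfolding Phi_def using ge by (intro prod_mono) auto
  finally show ?thesis .
qed

lemma Phi_init:
  assumes "j < m"
  shows "Phi j \<kappa> 0 / Phi_thr j \<le> exp (- l)"
proof -
  note lb = lam_bounds[OF assms] and db = dev_bounds[OF assms] and wb = wcap_bounds[OF assms]
  have "lam j * 1 \<le> lam j * wcap j" using lb wb by (intro mult_left_mono) auto
  then have l1: "lam j \<le> 1" using lb db by simp
  have "Phi j \<kappa> 0 = (1 - lam j) ^ N"
    using es_nth(3)[OF assms] by (simp add: Phi_def weight_def)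
  also have "\<dots> \<le> exp (- lam j) ^ N"
    using l1 exp_ge_add_one_self[of "- lam j"] by (intro power_mono) auto
  also have "\<dots> = exp (- (lam j * N))" by (simp flip: exp_of_nat_mult add: ac_simps)
  finally have "Phi j \<kappa> 0 / Phi_thr j \<le> exp (- (lam j * N)) / Phi_thr j"
    by (intro divide_right_mono) (auto simp: Phi_thr_def)
  also have "\<dots> = exp (- (lam j * N * dev j / 2))"
    by (simp add: Phi_thr_def algebra_simps flip: exp_diff)
  also have "lam j * N * dev j / 2 = (dev j)\<^sup>2 * N / (8 * wcap j)"
    by (simp add: lam_def power2_eq_square)
  also have "\<dots> = l" using dev_sq[OF assms] wb N_q by simp
  finally show ?thesis .
qed

section \<open>Upper tails of neighbour sums\<close>

lemma Xi_arg_bounds: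
  assumes "all_good \<kappa> t" "t \<le> m" "i < m" "u \<in> V" "c \<in> C"
  shows "0 \<le> eta * coef i * state \<kappa> (min t i) u c" "eta * coef i * state \<kappa> (min t i) u c \<le> 1/8"
    "good \<kappa> (min t i) \<Longrightarrow> eta * coef i * state \<kappa> (min t i) u c \<le> 2 * (eta * B)"
proof -
  have c: "0 \<le> eta * coef i" using eta_bounds coef_bounds[OF assms(3)] by simp
  then show "0 \<le> eta * coef i * state \<kappa> (min t i) u c" using state_nonneg by simp
  have "state \<kappa> (min t i) u c \<le> 2 * cap u (min t i)"
    using assms by (intro state_le) (auto simp: all_good_def)
  also have "\<dots> \<le> 2 * B" using cap_bounds[of "min t i" u] assms by simp
  finally have "eta * coef i * state \<kappa> (min t i) u c \<le> (eta * coef i) * (2 * B)"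
    using c by (intro mult_left_mono)
  \<comment> \<open>One 2 bounds \<open>coef i\<close>, the other is the possible doubling of a cap
    at a first violation.\<close>
  also have "\<dots> \<le> (eta * 2) * (2 * B)"
    using eta_bounds coef_bounds[OF assms(3)] B_pos by (intro mult_right_mono mult_left_mono) auto
  also have "\<dots> \<le> 1/8" using eta_bounds by simp
  finally show "eta * coef i * state \<kappa> (min t i) u c \<le> 1/8" .
  assume g: "good \<kappa> (min t i)"
  then have "state \<kappa> (min t i) u c \<le> cap u (min t i)" using assms by (auto simp: good_def)
  also have "\<dots> \<le> B" using cap_bounds[of "min t i" u] assms by simp
  finally have "eta * coef i * state \<kappa> (min t i) u c \<le> (eta * coef i) * B"
    using c by (intro mult_left_mono)
  also have "\<dots> \<le> (eta * 2) * B"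
    using eta_bounds coef_bounds[OF assms(3)] B_pos by (intro mult_right_mono mult_left_mono) auto
  finally show "eta * coef i * state \<kappa> (min t i) u c \<le> 2 * (eta * B)" by simp
qed

lemma Xi_nonneg:
  assumes "all_good \<kappa> t" "t \<le> m" "j \<le> m"
  shows "0 \<le> Xi v c j \<kappa> t"
  unfolding Xi_def
proof (rule prod_nonneg)
  fix i assume i: "i \<in> idx v c j"
  note d = idxD[OF i assms(3)]
  show "0 \<le> bump (eta * coef i * state \<kappa> (min t i) (other (es ! i) v) c)"
    using Xi_arg_bounds[OF assms(1,2) d(2,6,7)] by (intro bump_nonneg) auto
qed

text \<open>An arriving edge can change the weights of at most two neighbours of \<open>v\<close>, and it
  changes them simultaneously.\<close>

lemma Xi_step:
  assumes t: "t < m" "j \<le> m" and ag: "all_good \<kappa> t" and g: "good \<kappa> t"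
  shows "(\<Sum>k\<in>T (es ! t). prob_at \<kappa> t k * Xi v c j (\<kappa>(t := k)) (Suc t)) \<le> Xi v c j \<kappa> t"
proof -
  have pos: "0 < total_at \<kappa> t" using good_total[OF t(1) g] by simp
  have sum1: "(\<Sum>k\<in>T (es ! t). prob_at \<kappa> t k) = 1" by (rule sum_color_prob[OF pos])
  define o' where "o' i = other (es ! i) v" for i
  \<comment> \<open>The factors that can change now: not yet frozen, with an affected endpoint and a
    color on the current list.\<close>
  define J where "J = {i \<in> idx v c j. t < i \<and> o' i \<in> es ! t \<and> c \<in> T (es ! t)}"
  define x where "x i = eta * coef i * state \<kappa> (min t i) (o' i) c" for i
  have unch: "state (\<kappa>(t := k)) (min (Suc t) i) (o' i) c = state \<kappa> (min t i) (o' i) c"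
    if "i \<in> idx v c j - J" for i k
  proof (cases "t < i")
    case True
    then have "min (Suc t) i = Suc t" "min t i = t" by auto
    moreover have "o' i \<notin> es ! t \<or> c \<notin> T (es ! t)" using True that by (auto simp: J_def)
    ultimately show ?thesis by (simp only: state_Suc_disjoint state_upd[OF order_refl])
  next
    case False
    then have "min (Suc t) i = i" "min t i = i" by auto
    then show ?thesis using False by simp
  qed
  have finJ: "finite J" by (simp add: J_def)
  define R where "R = (\<Prod>i\<in>idx v c j - J. bump (x i))"
  have split: "Xi v c j \<kappa>' s = (\<Prod>i\<in>idx v c j - J. bump (eta * coef i * state \<kappa>' (min s i) (o' i) c))
     * (\<Prod>i\<in>J. bump (eta * coef i * state \<kappa>' (min s i) (o' i) c))" for \<kappa>' s
    unfolding Xi_def o'_def[symmetric] by (rule prod.subset_diff) (auto simp: J_def)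
  have Xi0: "Xi v c j \<kappa> t = R * (\<Prod>i\<in>J. bump (x i))"
    unfolding split R_def x_def ..
  show ?thesis
  proof (cases "c \<in> T (es ! t)")
    case False
    then have "J = {}" by (simp add: J_def)
    then have "Xi v c j (\<kappa>(t := k)) (Suc t) = Xi v c j \<kappa> t" for k
      unfolding split using unch[of _ k] by simp
    then show ?thesis using sum1 by (simp flip: sum_distrib_right)
  next
    case True
    define p where "p = prob_at \<kappa> t c"
    have p: "0 \<le> p" "p \<le> 1/2"
      using good_prob_le[OF t(1) g True] color_prob_nonneg[of "state \<kappa> t", OF state_nonneg] by (auto simp: p_def)
    have Xi1: "Xi v c j (\<kappa>(t := k)) (Suc t) = R * (if k = c then 1 else (\<Prod>i\<in>J. bump (x i / (1 - p))))" for k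
    proof -
      have "(\<Prod>i\<in>idx v c j - J. bump (eta * coef i * state (\<kappa>(t := k)) (min (Suc t) i) (o' i) c)) = R"
        unfolding R_def x_def using unch[of _ k] by simp
      moreover have "bump (eta * coef i * state (\<kappa>(t := k)) (min (Suc t) i) (o' i) c)
         = (if k = c then 1 else bump (x i / (1 - p)))" if "i \<in> J" for i
      proof -
        have "min (Suc t) i = Suc t" "min t i = t" "o' i \<in> es ! t" using that by (auto simp: J_def)
        then show ?thesis using True by (auto simp: update_def x_def p_def bump_def)
      qed
      ultimately show ?thesis unfolding split by simp
    qed
    have x: "0 \<le> x i" "x i \<le> 1/8" if "i \<in> idx v c j" for i
      using Xi_arg_bounds[OF ag _ idxD(2,6,7)[OF that t(2)]] t by (auto simp: x_def o'_def)
    have R0: "0 \<le> R" unfolding R_def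
      using x by (intro prod_nonneg bump_nonneg) (force intro: order_trans)+
    \<comment> \<open>Edges at \<open>v\<close> with the same other endpoint coincide, so at most
      two factors change.\<close>
    have inj: "inj_on o' J"
    proof (rule inj_onI)
      fix i i' assume i: "i \<in> J" "i' \<in> J" "o' i = o' i'"
      have i2: "i \<in> idx v c j" "i' \<in> idx v c j" using i by (auto simp: J_def)
      have "es ! i = es ! i'"
        using edge_eq_other(1)[OF es_nth(1) idxD(3)[OF i2(1) t(2)]] edge_eq_other(1)[OF es_nth(1) idxD(3)[OF i2(2) t(2)]]
          idxD(2)[OF i2(1) t(2)] idxD(2)[OF i2(2) t(2)] i(3) by (simp add: o'_def)
      then show "i = i'"
        using distinct_es idxD(2)[OF i2(1) t(2)] idxD(2)[OF i2(2) t(2)] by (simp add: nth_eq_iff_index_eq)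
    qed
    have "card J \<le> card (es ! t)"
      using es_nth(1)[OF t(1)] by (intro card_inj_on_le[OF inj]) (auto simp: J_def intro: card_ge_0_finite)
    then have "card J = 0 \<or> card J = 1 \<or> card J = 2" using es_nth(1)[OF t(1)] by linarith
    then have main: "p + (1 - p) * (\<Prod>i\<in>J. bump (x i / (1 - p))) \<le> (\<Prod>i\<in>J. bump (x i))"
    proof (elim disjE)
      assume "card J = 0"
      then show ?thesis using finJ by simp
    next
      assume "card J = 1"
      then obtain a where "J = {a}" by (auto simp: card_1_singleton_iff)
      then show ?thesis using bump_mean_le[of p "x a"] p by simp
    next
      assume "card J = 2"
      then obtain a b where ab: "J = {a, b}" "a \<noteq> b" by (auto simp: card_2_iff)
      then have "a \<in> idx v c j" "b \<in> idx v c j" by (auto simp: J_def)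
      then show ?thesis using bump_pair_mean_le[of p "x a" "x b"] p x[of a] x[of b] ab by simp
    qed
    have fin: "finite (T (es ! t))" using es_nth(2)[OF t(1)] .
    have rest: "(\<Sum>k\<in>T (es ! t) - {c}. prob_at \<kappa> t k) = 1 - p"
      using sum.remove[OF fin True, of "prob_at \<kappa> t"] sum1 by (simp add: p_def)
    have "(\<Sum>k\<in>T (es ! t). prob_at \<kappa> t k * (R * (if k = c then 1 else Q))) = R * (p + (1 - p) * Q)" for Q
    proof -
      have "(\<Sum>k\<in>T (es ! t). prob_at \<kappa> t k * (R * (if k = c then 1 else Q)))
        = p * R + (\<Sum>k\<in>T (es ! t) - {c}. prob_at \<kappa> t k) * (R * Q)"
        by (subst sum.remove[OF fin True]) (simp add: p_def sum_distrib_right)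
      also have "\<dots> = p * R + (1 - p) * (R * Q)" by (simp only: rest)
      finally show ?thesis by (simp add: algebra_simps)
    qed
    then have "(\<Sum>k\<in>T (es ! t). prob_at \<kappa> t k * Xi v c j (\<kappa>(t := k)) (Suc t))
      = R * (p + (1 - p) * (\<Prod>i\<in>J. bump (x i / (1 - p))))"
      unfolding Xi1 .
    also have "\<dots> \<le> Xi v c j \<kappa> t" unfolding Xi0 using main R0 by (rule mult_left_mono)
    finally show ?thesis .
  qed
qed

lemma inverse_one_minus_dev: "i < m \<Longrightarrow> 1 / (1 - dev i) \<le> coef i"
proof -
  assume i: "i < m"
  have "0 \<le> dev i * (1 - 2 * dev i)" using dev_bounds[OF i] by (intro mult_nonneg_nonneg) auto
  then show ?thesis using dev_bounds[OF i] by (subst divide_le_eq) (auto simp: coef_def algebra_simps)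
qed

text \<open>A weight above its cap forces the sum in \<open>inverse_state\<close> above
  \<open>1 - 1 / cap v t\<close>. All earlier total weights were good, so each may be replaced by
  \<open>N\<close> at the cost of \<open>coef i\<close>.\<close>

lemma Xi_bad:
  assumes t: "t \<le> m" and ag: "all_good \<kappa> t" and bad: "cap v t < state \<kappa> t v c"
  shows "Xi_thr v t \<le> Xi v c t \<kappa> t"
proof -
  let ?z = "\<lambda>i. state \<kappa> i (other (es ! i) v) c"
  define S where "S = (\<Sum>i\<in>idx v c t. coef i * ?z i)"
  have cap: "2 \<le> cap v t" using cap_bounds(1)[OF t] .
  have "1 - 1 / cap v t < 1 - 1 / state \<kappa> t v c"
    using bad cap by (simp add: frac_less2)
  also have "\<dots> = (\<Sum>i\<in>idx v c t. ?z i / total_at \<kappa> i)"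
    using inverse_state[OF t ag, of v c] bad cap by auto
  also have "\<dots> \<le> (\<Sum>i\<in>idx v c t. coef i * ?z i / N)"
  proof (rule sum_mono)
    fix i assume i: "i \<in> idx v c t"
    have im: "i < m" using idxD(2)[OF i t] .
    have g: "good \<kappa> i" using ag i by (auto simp: all_good_def idx_def)
    have d: "0 < 1 - dev i" using dev_bounds[OF im] by simp
    have "?z i / total_at \<kappa> i \<le> ?z i / (N * (1 - dev i))"
      using g im d N_q state_nonneg good_total[OF im g]
      by (intro divide_left_mono) (auto simp: good_def)
    also have "\<dots> = (1 / (1 - dev i)) * (?z i / N)" by simp
    also have "\<dots> \<le> coef i * (?z i / N)"
      using inverse_one_minus_dev[OF im] state_nonneg by (intro mult_right_mono) auto
    finally show "?z i / total_at \<kappa> i \<le> coef i * ?z i / N" by simp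
  qed
  also have "\<dots> = S / N" by (simp add: S_def sum_divide_distrib)
  finally have "(1 - 1 / cap v t) * N < S" using N_q by (simp add: less_divide_eq)
  moreover have "(1 - 1 / cap v t) * N = (N + deg v t) / 2"
    using N_q by (simp add: cap_def field_simps)
  ultimately have S: "(N + deg v t) / 2 \<le> S" by simp
  have "Xi_thr v t \<le> exp (eta * (1 - 4 * eta * B) * S)"
    unfolding Xi_thr_def exp_le_cancel_iff
    using S eta_bounds by (intro mult_left_mono mult_nonneg_nonneg) auto
  also have "\<dots> = (\<Prod>i\<in>idx v c t. exp (eta * coef i * ?z i * (1 - 4 * eta * B)))"
    by (simp add: S_def sum_distrib_left exp_sum[symmetric] ac_simps)
  also have "\<dots> \<le> Xi v c t \<kappa> t"
    unfolding Xi_def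
  proof (intro prod_mono conjI)
    fix i assume i: "i \<in> idx v c t"
    have it: "min t i = i" "i < t" using idxD(1)[OF i t] by auto
    have g: "good \<kappa> (min t i)" using ag it by (auto simp: all_good_def)
    define x where "x = eta * coef i * ?z i"
    have x: "0 \<le> x" "x \<le> 1/8" "x \<le> 2 * (eta * B)"
      using Xi_arg_bounds[OF ag t idxD(2,6,7)[OF i t]] g it by (auto simp: x_def)
    have "x * x \<le> x * (2 * (eta * B))" using x by (intro mult_left_mono) auto
    then have "x * (1 - 4 * eta * B) \<le> x - 2 * x\<^sup>2" by (simp add: power2_eq_square algebra_simps)
    then have "exp (x * (1 - 4 * eta * B)) \<le> exp (x - 2 * x\<^sup>2)" by simp
    also have "\<dots> \<le> bump x" using x by (intro exp_le_bump) auto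
    finally show "exp (eta * coef i * ?z i * (1 - 4 * eta * B))
      \<le> bump (eta * coef i * state \<kappa> (min t i) (other (es ! i) v) c)"
      by (simp add: x_def it)
  qed simp
  finally show ?thesis .
qed

end

section \<open>The failure probability\<close>

text \<open>Bounds inverse square roots by a telescoping difference.\<close>

lemma inverse_sqrt_le:
  fixes x :: real
  assumes "1 \<le> x"
  shows "1 / sqrt x \<le> 2 * (sqrt x - sqrt (x - 1))"
proof -
  have "(sqrt x - sqrt (x - 1)) * (sqrt x + sqrt (x - 1)) = 1"
    using assms by (simp add: algebra_simps)
  moreover have "(sqrt x - sqrt (x - 1)) * (sqrt x + sqrt (x - 1)) \<le> (sqrt x - sqrt (x - 1)) * (2 * sqrt x)"
    using assms by (intro mult_left_mono) auto
  ultimately show ?thesis using assms by (subst divide_le_eq) (auto simp: ac_simps)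
qed

context capped_coloring
begin

text \<open>Along the edges at \<open>v\<close> the quantity \<open>N - deg v i\<close> decreases by
  exactly 1 each time, so the bounds telescope.\<close>

lemma sum_inverse_sqrt:
  "j \<le> m \<Longrightarrow> (\<Sum>i | i < j \<and> v \<in> es ! i. 1 / sqrt (real N - deg v i)) \<le> 2 * (sqrt N - sqrt (real N - deg v j))"
proof (induction j)
  case 0
  then show ?case by (simp add: deg_def)
next
  case (Suc j)
  show ?case
  proof (cases "v \<in> es ! j")
    case False
    then have "{i. i < Suc j \<and> v \<in> es ! i} = {i. i < j \<and> v \<in> es ! i}" by (auto simp: less_Suc_eq)
    then show ?thesis using Suc False by (simp add: deg_Suc)
  next
    case True
    then have "{i. i < Suc j \<and> v \<in> es ! i} = insert j {i. i < j \<and> v \<in> es ! i}" by (auto simp: less_Suc_eq)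
    moreover have "1 \<le> real N - deg v j"
      using deg_le[OF Suc.prems, of v] q_pos True by (simp add: deg_Suc)
    note inverse_sqrt_le[OF this]
    ultimately show ?thesis using Suc True by (simp add: deg_Suc algebra_simps)
  qed
qed

text \<open>Only the cap of the other endpoint is bounded by \<open>B\<close>; the cap of
  \<open>v\<close> is kept, so the errors behave like inverse square roots of
  \<open>N - deg v i\<close>.\<close>

lemma sum_dev_le:
  assumes "j \<le> m"
  shows "(\<Sum>i | i < j \<and> v \<in> es ! i. dev i) \<le> q / 8"
proof -
  define K where "K = sqrt (32 * l * N / q)"
  have "(\<Sum>i | i < j \<and> v \<in> es ! i. dev i) \<le> (\<Sum>i | i < j \<and> v \<in> es ! i. K * (1 / sqrt (real N - deg v i)))"
  proof (rule sum_mono)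
    fix i assume "i \<in> {i. i < j \<and> v \<in> es ! i}"
    then have i: "i < m" "v \<in> es ! i" using assms by auto
    have "8 * l * wcap i / N \<le> 8 * l * (cap v i * B) / N"
      using wcap_bounds(3)[OF i] l_ge by (intro divide_right_mono mult_left_mono) auto
    also have "\<dots> = (32 * l * N / q) / (real N - deg v i)"
      using N_q by (simp add: cap_def B_def ac_simps)
    finally show "dev i \<le> K * (1 / sqrt (real N - deg v i))"
      unfolding dev_def K_def by (simp flip: real_sqrt_divide)
  qed
  also have "\<dots> = K * (\<Sum>i | i < j \<and> v \<in> es ! i. 1 / sqrt (real N - deg v i))"
    by (simp add: sum_distrib_left)
  also have "\<dots> \<le> K * (2 * (sqrt N - sqrt (real N - deg v j)))"
    using l_ge q_pos by (intro mult_left_mono sum_inverse_sqrt assms) (auto simp: K_def)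
  also have "\<dots> \<le> K * (2 * sqrt N)"
    using deg_le[OF assms, of v] q_pos l_ge by (intro mult_left_mono) (auto simp: K_def)
  also have "\<dots> = 2 * sqrt (32 * l * N / q * N)"
    by (simp only: K_def real_sqrt_mult[of "32 * l * N / q" "real N"] mult.left_commute[of 2])
  also have "\<dots> \<le> 2 * (q / 16)"
  proof -
    \<comment> \<open>Here the constant of \<open>q_cube\<close> arises: 8192 = 32 * 16^2.\<close>
    have "8192 * (l * (real N * real N)) \<le> q * (q * q)"
      using q_cube by (simp add: power2_eq_square power3_eq_cube ac_simps)
    then have "8192 * (l * (real N * real N)) / (256 * q) \<le> q * (q * q) / (256 * q)"
      using q_pos by (intro divide_right_mono) auto
    then have "32 * l * N / q * N \<le> (q / 16)\<^sup>2"
      using q_pos by (simp add: power2_eq_square ac_simps)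
    then have "sqrt (32 * l * N / q * N) \<le> q / 16" using q_pos by (intro real_le_lsqrt) auto
    then show ?thesis by simp
  qed
  finally show ?thesis by simp
qed

text \<open>Initially all weights are 1, so the exponent is about \<open>eta * deg v j\<close>,
  which is below the one of the threshold by \<open>eta\<close> times a multiple of
  \<open>q\<close>.\<close>

lemma Xi_init:
  assumes j: "j \<le> m"
  shows "Xi v c j \<kappa> 0 / Xi_thr v j \<le> exp (- l)"
proof -
  have "Xi v c j \<kappa> 0 \<le> (\<Prod>i\<in>idx v c j. exp (eta * coef i))"
    unfolding Xi_def
  proof (intro prod_mono conjI)
    fix i assume i: "i \<in> idx v c j"
    have "all_good \<kappa> 0" by (simp add: all_good_def)
    note Xi_arg_bounds(1,2)[OF this _ idxD(2,6,7)[OF i j]]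
    then show "0 \<le> bump (eta * coef i * state \<kappa> (min 0 i) (other (es ! i) v) c)"
      by (intro bump_nonneg) auto
    show "bump (eta * coef i * state \<kappa> (min 0 i) (other (es ! i) v) c) \<le> exp (eta * coef i)"
      using bump_le_exp by simp
  qed
  also have "\<dots> = exp (eta * (\<Sum>i\<in>idx v c j. coef i))" by (simp add: sum_distrib_left exp_sum)
  also have "\<dots> \<le> exp (eta * (deg v j + q / 4))"
  proof -
    have "(\<Sum>i\<in>idx v c j. coef i) \<le> (\<Sum>i | i < j \<and> v \<in> es ! i. coef i)"
      using coef_bounds j by (intro sum_mono2) (force simp: idx_def intro: order_trans[OF zero_le_one])+
    also have "\<dots> = deg v j + 2 * (\<Sum>i | i < j \<and> v \<in> es ! i. dev i)"
      by (simp add: coef_def sum.distrib sum_distrib_left deg_def)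
    also have "\<dots> \<le> deg v j + q / 4" using sum_dev_le[OF j, of v] by simp
    finally show ?thesis using eta_bounds by simp
  qed
  finally have "Xi v c j \<kappa> 0 / Xi_thr v j \<le> exp (eta * (deg v j + q / 4)) / Xi_thr v j"
    by (intro divide_right_mono) (auto simp: Xi_thr_def)
  also have "\<dots> = exp (eta * ((deg v j + q / 4) - (1 - 4 * (eta * B)) * ((N + deg v j) / 2)))"
    by (simp add: Xi_thr_def exp_diff[symmetric] right_diff_distrib ac_simps)
  also have "\<dots> \<le> exp (- l)"
  proof -
    have d: "deg v j \<le> real N - q" using deg_le[OF j] .
    have "(eta * B) * ((N + deg v j) / 2) \<le> (eta * B) * N"
      using d q_pos eta_bounds B_pos by (intro mult_left_mono) auto
    also have "\<dots> = q / 32" using eta_bounds N_q by simp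
    finally have Y: "(eta * B) * ((N + deg v j) / 2) \<le> q / 32" .
    define Y where "Y = (eta * B) * ((N + deg v j) / 2)"
    have e: "(1 - 4 * (eta * B)) * ((N + deg v j) / 2) = (N + deg v j) / 2 - 4 * Y"
      by (simp only: left_diff_distrib mult_1_left mult.assoc Y_def)
    \<comment> \<open>The gap is at least \<open>q / 2\<close>; the \<open>coef\<close> terms cost
      \<open>q / 4\<close> and the second-order loss \<open>q / 8\<close>.\<close>
    have a: "(deg v j + q / 4) - (1 - 4 * (eta * B)) * ((N + deg v j) / 2) \<le> - (q / 8)"
      unfolding e unfolding of_nat_add using d Y[folded Y_def] by argo
    have "512 * real N * real N * l \<le> 8192 * real N * real N * l"
      using l_ge by (intro mult_right_mono) auto
    also have "\<dots> \<le> q ^ 3" using q_cube by (simp add: power2_eq_square ac_simps)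
    finally have "l \<le> q ^ 3 / (512 * real N * real N)"
      using N_q by (subst le_divide_eq) (simp add: ac_simps)
    also have "\<dots> = eta * (q / 8)" by (simp add: eta_def B_def power3_eq_cube)
    finally have "l \<le> eta * (q / 8)" .
    moreover have "eta * ((deg v j + q / 4) - (1 - 4 * (eta * B)) * ((N + deg v j) / 2)) \<le> eta * (- (q / 8))"
      using a eta_bounds by (intro mult_left_mono) auto
    ultimately show ?thesis by simp
  qed
  finally show ?thesis .
qed

text \<open>A union bound as one potential. A \<open>Phi\<close> term is dropped once its edge has
  arrived, as its supermartingale property ends there; \<open>Xi\<close> factors freeze instead, so
  those terms remain.\<close>

definition Psi :: "(nat \<Rightarrow> nat) \<Rightarrow> nat \<Rightarrow> real" where
  "Psi \<kappa> t = (\<Sum>j\<in>{t..<m}. Phi j \<kappa> t / Phi_thr j)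
     + (\<Sum>(v, c, j)\<in>V \<times> C \<times> {..m}. Xi v c j \<kappa> t / Xi_thr v j)"

lemma Psi_init: "Psi \<kappa> 0 \<le> (m + card V * card C * (m + 1)) * exp (- l)"
proof -
  have "(\<Sum>j\<in>{0..<m}. Phi j \<kappa> 0 / Phi_thr j) \<le> card {0..<m} * exp (- l)"
    using Phi_init by (intro sum_bounded_above) auto
  moreover have "(\<Sum>(v, c, j)\<in>V \<times> C \<times> {..m}. Xi v c j \<kappa> 0 / Xi_thr v j) \<le> card (V \<times> C \<times> {..m}) * exp (- l)"
    using Xi_init by (intro sum_bounded_above) auto
  moreover have "card (V \<times> C \<times> {..m}) = card V * card C * (m + 1)"
    by (simp add: card_cartesian_product algebra_simps)
  ultimately show ?thesis unfolding Psi_def by (simp add: algebra_simps)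
qed

lemma Psi_parts_nonneg:
  assumes "t \<le> m" "all_good \<kappa> t"
  shows "j \<in> {t..<m} \<Longrightarrow> 0 \<le> Phi j \<kappa> t / Phi_thr j" "j \<le> m \<Longrightarrow> 0 \<le> Xi v c j \<kappa> t / Xi_thr v j"
  using Phi_nonneg[of t j \<kappa>] Xi_nonneg[of \<kappa> t j v c] assms by (auto simp: Phi_thr_def Xi_thr_def)

lemma Psi_sums_nonneg:
  assumes "t \<le> m" "all_good \<kappa> t"
  shows "0 \<le> (\<Sum>j\<in>{t..<m}. Phi j \<kappa> t / Phi_thr j)"
    "0 \<le> (\<Sum>(v, c, j)\<in>V \<times> C \<times> {..m}. Xi v c j \<kappa> t / Xi_thr v j)"
  using Psi_parts_nonneg[OF assms] by (auto intro!: sum_nonneg)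

lemma Psi_bad:
  assumes t: "t \<le> m" and ag: "all_good \<kappa> t" and bad: "\<not> good \<kappa> t"
  shows "1 \<le> Psi \<kappa> t"
proof (cases "\<exists>v\<in>V. \<exists>c\<in>C. cap v t < state \<kappa> t v c")
  case True
  then obtain v c where vc: "v \<in> V" "c \<in> C" "cap v t < state \<kappa> t v c" by auto
  have "1 \<le> (\<lambda>(v, c, j). Xi v c j \<kappa> t / Xi_thr v j) (v, c, t)"
    using Xi_bad[OF t ag vc(3)] by (simp add: Xi_thr_def)
  also have "\<dots> \<le> (\<Sum>(v, c, j)\<in>V \<times> C \<times> {..m}. Xi v c j \<kappa> t / Xi_thr v j)"
    using vc t Psi_parts_nonneg[OF t ag] finite_V finite_C by (intro member_le_sum) auto
  finally show ?thesis using Psi_sums_nonneg[OF t ag] by (simp add: Psi_def)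
next
  case False
  then have le: "\<And>v c. v \<in> V \<Longrightarrow> c \<in> C \<Longrightarrow> state \<kappa> t v c \<le> cap v t" by (meson not_le)
  then have b: "t < m" "total_at \<kappa> t < real N * (1 - dev t)"
    using bad by (auto simp: good_def not_le)
  have "1 \<le> Phi t \<kappa> t / Phi_thr t" using Phi_bad[OF b(1) le b(2)] by (simp add: Phi_thr_def)
  also have "\<dots> \<le> (\<Sum>j\<in>{t..<m}. Phi j \<kappa> t / Phi_thr j)"
    using b Psi_parts_nonneg[OF t ag] by (intro member_le_sum) auto
  finally show ?thesis using Psi_sums_nonneg[OF t ag] by (simp add: Psi_def)
qed

lemma Psi_step:
  assumes t: "t < m" and ag: "all_good \<kappa> t" and g: "good \<kappa> t"
  shows "(\<Sum>k\<in>T (es ! t). prob_at \<kappa> t k * Psi (\<kappa>(t := k)) (Suc t)) \<le> Psi \<kappa> t"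
proof -
  let ?p = "prob_at \<kappa> t" and ?T = "T (es ! t)" and ?I = "V \<times> C \<times> {..m}"
  have "(\<Sum>k\<in>?T. ?p k * (\<Sum>j\<in>{Suc t..<m}. Phi j (\<kappa>(t := k)) (Suc t) / Phi_thr j))
    = (\<Sum>j\<in>{Suc t..<m}. (\<Sum>k\<in>?T. ?p k * Phi j (\<kappa>(t := k)) (Suc t)) / Phi_thr j)"
    unfolding sum_divide_distrib sum_distrib_left times_divide_eq_right by (rule sum.swap)
  also have "\<dots> \<le> (\<Sum>j\<in>{Suc t..<m}. Phi j \<kappa> t / Phi_thr j)"
    using Phi_step[OF _ _ g] by (intro sum_mono divide_right_mono) (auto simp: Phi_thr_def)
  \<comment> \<open>The dropped term \<open>j = t\<close> is nonnegative.\<close>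
  also have "\<dots> \<le> (\<Sum>j\<in>{t..<m}. Phi j \<kappa> t / Phi_thr j)"
    using Psi_parts_nonneg[of t \<kappa>] t ag by (intro sum_mono2) auto
  finally have 1: "(\<Sum>k\<in>?T. ?p k * (\<Sum>j\<in>{Suc t..<m}. Phi j (\<kappa>(t := k)) (Suc t) / Phi_thr j))
    \<le> (\<Sum>j\<in>{t..<m}. Phi j \<kappa> t / Phi_thr j)" .
  have "(\<Sum>k\<in>?T. ?p k * (\<Sum>(v, c, j)\<in>?I. Xi v c j (\<kappa>(t := k)) (Suc t) / Xi_thr v j))
    = (\<Sum>(v, c, j)\<in>?I. (\<Sum>k\<in>?T. ?p k * Xi v c j (\<kappa>(t := k)) (Suc t)) / Xi_thr v j)"
    unfolding case_prod_beta sum_divide_distrib sum_distrib_left times_divide_eq_right by (rule sum.swap)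
  also have "\<dots> \<le> (\<Sum>(v, c, j)\<in>?I. Xi v c j \<kappa> t / Xi_thr v j)"
    using Xi_step[OF t _ ag g] by (intro sum_mono) (auto simp: Xi_thr_def intro!: divide_right_mono)
  finally have 2: "(\<Sum>k\<in>?T. ?p k * (\<Sum>(v, c, j)\<in>?I. Xi v c j (\<kappa>(t := k)) (Suc t) / Xi_thr v j))
    \<le> (\<Sum>(v, c, j)\<in>?I. Xi v c j \<kappa> t / Xi_thr v j)" .
  show ?thesis
    unfolding Psi_def distrib_left sum.distrib using 1 2 by (rule add_mono)
qed

lemma weight_strategy_failure_le:
  assumes "\<And>e. e \<in> set es \<Longrightarrow> T e = tr (L e)" and "\<And>e. e \<in> set es \<Longrightarrow> T e \<subseteq> L e"
  shows "measure_pmf.prob (run (weight_strategy tr) L [] es)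
      {h. \<not> valid_list_edge_coloring (set es) L (coloring_of h)}
    \<le> (m + card V * card C * (m + 1)) * exp (- l)"
proof -
  \<comment> \<open>Any \<open>\<kappa>\<close> serves, since nothing has been chosen at time
    0.\<close>
  fix \<kappa> :: "nat \<Rightarrow> nat"
  have "measure_pmf.prob (run (weight_strategy tr) L (hist L \<kappa> 0) (drop 0 es))
      {h. \<not> valid_list_edge_coloring (set es) L (coloring_of h)} \<le> Psi \<kappa> 0"
  proof (rule run_failure_le[where Inv = all_good])
    fix \<kappa>
    show "all_good \<kappa> m \<Longrightarrow> 0 \<le> Psi \<kappa> m" unfolding Psi_def using Psi_sums_nonneg[of m \<kappa>] by simp
  next
    fix \<kappa> t assume t: "t < m" and ag: "all_good \<kappa> t" and "Psi \<kappa> t < 1"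
    then have g: "good \<kappa> t" using Psi_bad[of t \<kappa>] by force
    have "all_good (\<kappa>(t := k)) (Suc t)" for k
      using ag g by (auto simp: all_good_def good_def less_Suc_eq)
    then show "0 < total_at \<kappa> t \<and>
      (\<forall>k\<in>T (es ! t). 0 < weight (state \<kappa> t) (es ! t) k \<longrightarrow> all_good (\<kappa>(t := k)) (Suc t)) \<and>
      (\<Sum>k\<in>T (es ! t). prob_at \<kappa> t k * Psi (\<kappa>(t := k)) (Suc t)) \<le> Psi \<kappa> t"
      using good_total[OF t g] Psi_step[OF t ag g] by simp
  qed (use assms in \<open>simp_all add: all_good_def legal_def\<close>)
  then show ?thesis using Psi_init[of \<kappa>] by (simp add: hist_def)
qed

end

section \<open>Choice of parameters\<close>

text \<open>As for a greedy coloring: fewer than \<open>\<Delta>\<close> colors are used at each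
  endpoint, so a free color is left, and free colors keep positive weight. The potential is
  constantly 0.\<close>

lemma (in edge_sequence) long_lists_failure_eq_0:
  assumes T_eq: "\<And>e. e \<in> set es \<Longrightarrow> T e = tr (L e)" and sub: "\<And>e. e \<in> set es \<Longrightarrow> T e \<subseteq> L e"
    and degree_le: "\<And>v. card {i. i < length es \<and> v \<in> es ! i} \<le> \<Delta>"
    and long: "\<And>e. e \<in> set es \<Longrightarrow> 2 * \<Delta> \<le> card (T e)"
  shows "measure_pmf.prob (run (weight_strategy tr) L [] es)
      {h. \<not> valid_list_edge_coloring (set es) L (coloring_of h)} = 0"
proof -
  fix \<kappa> :: "nat \<Rightarrow> nat"
  define Inv where "Inv \<kappa> t \<longleftrightarrow> (\<forall>v c. (\<forall>i<t. v \<in> es ! i \<longrightarrow> \<kappa> i \<noteq> c) \<longrightarrow> 0 < state \<kappa> t v c)"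
    for \<kappa> t
  have "measure_pmf.prob (run (weight_strategy tr) L (hist L \<kappa> 0) (drop 0 es))
      {h. \<not> valid_list_edge_coloring (set es) L (coloring_of h)} \<le> 0"
  proof (rule run_failure_le[where Inv = Inv])
    fix \<kappa> t assume t: "t < length es" and inv: "Inv \<kappa> t"
    have et: "es ! t \<in> set es" using t by simp
    have fin: "finite (es ! t)" "finite (T (es ! t))"
      using card_edge[OF et] finite_T[OF et] by (auto intro: card_ge_0_finite)
    define U where "U v = \<kappa> ` {i. i < t \<and> v \<in> es ! i}" for v
    have U: "card (U v) < \<Delta>" if "v \<in> es ! t" for v
    proof -
      have "card (U v) \<le> card {i. i < t \<and> v \<in> es ! i}" unfolding U_def by (rule card_image_le) simp
      also have "\<dots> < card {i. i < length es \<and> v \<in> es ! i}"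
        using t that by (intro psubset_card_mono) auto
      also have "\<dots> \<le> \<Delta>" by (rule degree_le)
      finally show ?thesis .
    qed
    obtain a b where ab: "es ! t = {a, b}" using card_edge[OF et] by (auto simp: card_2_iff)
    have "card (U a \<union> U b) \<le> card (U a) + card (U b)" by (rule card_Un_le)
    also have "\<dots> < card (T (es ! t))" using U[of a] U[of b] ab long[OF et] by simp
    finally have "\<not> T (es ! t) \<subseteq> U a \<union> U b"
      using card_mono[of "U a \<union> U b" "T (es ! t)"] by (auto simp: U_def)
    then obtain c where c: "c \<in> T (es ! t)" "c \<notin> U a" "c \<notin> U b" by auto
    have "0 < state \<kappa> t v c" if "v \<in> es ! t" for v
    proof -
      have "c \<notin> U v" using c ab that by auto
      then have "\<forall>i<t. v \<in> es ! i \<longrightarrow> \<kappa> i \<noteq> c" by (auto simp: U_def)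
      then show ?thesis using inv unfolding Inv_def by blast
    qed
    then have "0 < weight (state \<kappa> t) (es ! t) c"
      unfolding weight_def by (intro prod_pos) auto
    also have "\<dots> \<le> total_at \<kappa> t"
      unfolding total_weight_def using c fin by (intro member_le_sum weight_nonneg state_nonneg) auto
    finally have pos: "0 < total_at \<kappa> t" .
    have "Inv (\<kappa>(t := k)) (Suc t)"
      if k: "k \<in> T (es ! t)" "0 < weight (state \<kappa> t) (es ! t) k" for k
      unfolding Inv_def
    proof (intro allI impI)
      fix v c assume free: "\<forall>i<Suc t. v \<in> es ! i \<longrightarrow> (\<kappa>(t := k)) i \<noteq> c"
      then have "0 < state \<kappa> t v c" using inv by (auto simp: Inv_def less_Suc_eq)
      \<comment> \<open>The color \<open>k\<close> also has a positive share, so \<open>c\<close>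
        has probability below 1 and its update does not divide by 0.\<close>
      moreover have "prob_at \<kappa> t c < 1" if ck: "c \<noteq> k" "c \<in> T (es ! t)"
      proof -
        have "weight (state \<kappa> t) (es ! t) c + weight (state \<kappa> t) (es ! t) k
            = (\<Sum>c\<in>{c, k}. weight (state \<kappa> t) (es ! t) c)" using ck by simp
        also have "\<dots> \<le> total_at \<kappa> t"
          unfolding total_weight_def using ck k fin by (intro sum_mono2 weight_nonneg state_nonneg) auto
        finally show ?thesis using k pos by (simp add: color_prob_def)
      qed
      ultimately show "0 < state (\<kappa>(t := k)) (Suc t) v c"
        using free by (auto simp: update_def)
    qed
    then show "0 < total_at \<kappa> t \<and>
      (\<forall>k\<in>T (es ! t). 0 < weight (state \<kappa> t) (es ! t) k \<longrightarrow> Inv (\<kappa>(t := k)) (Suc t)) \<and>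
      (\<Sum>k\<in>T (es ! t). prob_at \<kappa> t k * 0) \<le> 0"
      using pos by simp
  qed (use assms in \<open>simp_all add: Inv_def legal_def\<close>)
  then show ?thesis by (simp add: hist_def measure_le_0_iff)
qed

section \<open>The slack function and trimmed lists\<close>

lemma q_nonneg: "1 \<le> n \<Longrightarrow> 0 \<le> q n \<Delta>"
  by (simp add: q_def)

text \<open>The left side is the cube of the last summand of \<open>q\<close>, and the other
  summands are nonnegative.\<close>

lemma q_cube_ge:
  assumes "1 \<le> n"
  shows "10 ^ 12 * ((real \<Delta>)\<^sup>2 * ln n) \<le> q n \<Delta> ^ 3"
proof -
  have "(real \<Delta> powr (2/3) * ln n powr (1/3)) ^ 3 = (real \<Delta>)\<^sup>2 * ln n"
    using assms by (cases "\<Delta> = 0"; cases "n = 1") (simp_all add: power_mult_distrib powr_power)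
  then have "10 ^ 12 * ((real \<Delta>)\<^sup>2 * ln n) = (10 ^ 4 * (real \<Delta> powr (2/3) * ln n powr (1/3))) ^ 3"
    by (simp add: power_mult_distrib)
  also have "\<dots> \<le> q n \<Delta> ^ 3"
    using assms by (intro power_mono) (auto simp: q_def)
  finally show ?thesis .
qed

definition list_length :: "nat \<Rightarrow> nat \<Rightarrow> nat" where
  "list_length n \<Delta> = nat \<lceil>real \<Delta> + q n \<Delta>\<rceil>"

text \<open>Gives all lists the same finite size. The choice depends on the list alone, so it can be
  made online.\<close>

definition trim :: "nat \<Rightarrow> nat set \<Rightarrow> nat set" where
  "trim N l = (SOME T. T \<subseteq> l \<and> finite T \<and> card T = N)"

lemma trim:
  assumes "infinite l \<or> N \<le> card l"
  shows "trim N l \<subseteq> l" "finite (trim N l)" "card (trim N l) = N"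
proof -
  have "\<exists>T. T \<subseteq> l \<and> finite T \<and> card T = N"
    using assms infinite_arbitrarily_large[of l N] obtain_subset_with_card_n[of N l]
    by (metis card.infinite finite_subset infinite_arbitrarily_large)
  from someI_ex[OF this] show "trim N l \<subseteq> l" "finite (trim N l)" "card (trim N l) = N"
    unfolding trim_def by auto
qed

definition weight_algorithm :: online_algorithm where
  "weight_algorithm n \<Delta> = weight_strategy (trim (list_length n \<Delta>))"

lemma list_size_suffices_weight_algorithm:
  "list_size_suffices weight_algorithm 1 n \<Delta> (real \<Delta> + q n \<Delta>)"
  unfolding list_size_suffices_def
proof (intro allI impI, elim conjE)
  fix V E and L :: "edge \<Rightarrow> nat set" and es
  assume G: "simple_graph V E" and n: "card V = n" and D: "max_degree V E = \<Delta>"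
    and es: "distinct es" "set es = E"
    and L: "\<forall>e\<in>E. infinite (L e) \<or> real (card (L e)) \<ge> real \<Delta> + q n \<Delta>"
  have V: "finite V" "V \<noteq> {}" and E: "\<And>e. e \<in> E \<Longrightarrow> e \<subseteq> V \<and> card e = 2"
    using G by (auto simp: simple_graph_def)
  have n1: "1 \<le> n" using V n by (auto simp: Suc_le_eq card_gt_0_iff)
  define N where "N = list_length n \<Delta>"
  define T where "T e = trim N (L e)" for e
  have N_real: "real \<Delta> + q n \<Delta> \<le> real N" "real N \<le> real \<Delta> + q n \<Delta> + 1"
    using q_nonneg[OF n1, of \<Delta>] unfolding N_def list_length_def by linarith+
  have T: "T e \<subseteq> L e" "finite (T e)" "card (T e) = N" if "e \<in> E" for e
  proof -
    have "infinite (L e) \<or> N \<le> card (L e)"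
      using L that unfolding N_def list_length_def by (auto simp: ceiling_le_iff nat_le_iff)
    then show "T e \<subseteq> L e" "finite (T e)" "card (T e) = N" unfolding T_def by (rule trim)+
  qed
  interpret edge_sequence es T
    using es E T by unfold_locales auto
  have deg: "card {i. i < length es \<and> v \<in> es ! i} \<le> \<Delta>" for v
  proof -
    have "(!) es ` {i. i < length es \<and> v \<in> es ! i} = {e \<in> E. v \<in> e}"
      using es by (auto simp: in_set_conv_nth)
    moreover have "inj_on ((!) es) {i. i < length es \<and> v \<in> es ! i}"
      using es by (auto simp: inj_on_def nth_eq_iff_index_eq)
    ultimately have "card {i. i < length es \<and> v \<in> es ! i} = degree E v"
      unfolding degree_def using card_image by metis
    moreover have "degree E v \<le> \<Delta>"
    proof (cases "v \<in> V")
      case True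
      then show ?thesis using V D by (auto simp: max_degree_def)
    next
      case False
      then have "{e \<in> E. v \<in> e} = {}" using E by blast
      then show ?thesis by (simp only: degree_def card.empty)
    qed
    ultimately show ?thesis by simp
  qed
  define S where "S = weight_strategy (trim N)"
  let ?bad = "{h. \<not> valid_list_edge_coloring E L (coloring_of h)}"
  have "measure_pmf.prob (run S L [] es) ?bad \<le> real n powr - 1"
  \<comment> \<open>For \<open>n = 1\<close> the claimed failure bound is 1. If
    \<open>\<Delta>\<close> is at most the slack, the lists have at least
    \<open>2 * \<Delta>\<close> colors.\<close>
  proof (cases "n = 1 \<or> real \<Delta> \<le> q n \<Delta>")
    case True
    then show ?thesis
    proof
      assume "n = 1"
      then show ?thesis by simp
    next
      assume "real \<Delta> \<le> q n \<Delta>"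
      then have "2 * \<Delta> \<le> N" using N_real by linarith
      then have "measure_pmf.prob (run S L [] es) ?bad = 0"
        unfolding S_def es(2)[symmetric] using deg T es
        by (intro long_lists_failure_eq_0[where \<Delta> = \<Delta>]) (auto simp: T_def)
      then show ?thesis by simp
    qed
  next
    case False
    then have n2: "2 \<le> n" and qD: "q n \<Delta> < real \<Delta>" using n1 by auto
    \<comment> \<open>The potential has at most \<open>n ^ 10\<close> terms, so 11 leaves a failure
      probability of at most \<open>1 / n\<close>.\<close>
    define l where "l = 11 * ln (real n)"
    have D1: "1 \<le> real \<Delta>" using qD q_nonneg[OF n1, of \<Delta>] by (cases \<Delta>) auto
    have ln2: "ln 2 \<le> ln (real n)" using n2 by simp
    have l1: "1 \<le> l" using ln2 ln2_ge_two_thirds by (simp add: l_def)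
    \<comment> \<open>Now \<open>N\<close> has the order of \<open>\<Delta>\<close>, so a cubic
      bound in \<open>\<Delta>\<close> becomes one in \<open>N\<close>; below, 811008 = 8192 * 9 *
      11.\<close>
    have N3: "real N \<le> 3 * real \<Delta>" using N_real qD D1 by linarith
    have "8192 * (real N)\<^sup>2 * l \<le> 8192 * (3 * real \<Delta>)\<^sup>2 * l"
      using N3 l1 by (intro mult_right_mono mult_left_mono power_mono) auto
    also have "\<dots> = 811008 * ((real \<Delta>)\<^sup>2 * ln (real n))" by (simp add: l_def power_mult_distrib)
    also have "\<dots> \<le> 10 ^ 12 * ((real \<Delta>)\<^sup>2 * ln (real n))"
      using n1 by (intro mult_right_mono) auto
    also have "\<dots> \<le> q n \<Delta> ^ 3" by (rule q_cube_ge[OF n1])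
    finally have cube: "8192 * (real N)\<^sup>2 * l \<le> q n \<Delta> ^ 3" .
    have qpos: "0 < q n \<Delta>"
      using n2 by (auto simp: q_def intro!: add_pos_nonneg)
    interpret capped_coloring es T N \<Delta> "q n \<Delta>" l
      using T es deg qpos N_real l1 cube by unfold_locales auto
    have m_le: "length es \<le> n ^ 2"
    proof -
      have "length es = card E" using es distinct_card by metis
      also have "\<dots> \<le> card {e. e \<subseteq> V \<and> card e = 2}" using E V by (intro card_mono) auto
      also have "\<dots> = n choose 2" using n_subsets[OF V(1)] n by simp
      also have "\<dots> \<le> n ^ 2" using n2 by (rule binomial_le_pow)
      finally show ?thesis .
    qed
    have "\<Delta> \<le> n ^ 2"
    proof -
      have "\<Delta> \<in> degree E ` V" using D V unfolding max_degree_def by (metis Max_in finite_imageI image_is_empty)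
      then obtain v where "\<Delta> = degree E v" by auto
      also have "\<dots> \<le> card E" unfolding degree_def using es by (intro card_mono) auto
      finally show ?thesis using m_le es distinct_card by (metis order_trans)
    qed
    then have N_le: "N \<le> 3 * n ^ 2" using N3 by linarith
    have V_le: "card (\<Union> (set es)) \<le> n" using E V n es by (metis Sup_least card_mono)
    have "card C \<le> (\<Sum>e\<in>E. card (T e))" unfolding C_def es(2) using es by (intro card_UN_le) auto
    also have "\<dots> = length es * N" using T es distinct_card[OF es(1)] by simp
    also have "\<dots> \<le> n ^ 2 * (3 * n ^ 2)" using m_le N_le by (intro mult_mono) auto
    finally have C_le: "card C \<le> 3 * n ^ 4" by (simp add: power2_eq_square power4_eq_xxxx)
    have "length es + card (\<Union> (set es)) * card C * (length es + 1) \<le> n ^ 2 + n * (3 * n ^ 4) * (n ^ 2 + 1)"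
      using m_le V_le C_le by (intro add_mono mult_mono) auto
    also have "\<dots> \<le> n ^ 10"
    proof -
      have a: "n ^ 2 \<le> n ^ 7" "n ^ 5 \<le> n ^ 7" using n1 by (auto intro: power_increasing)
      have "n ^ 2 + n * (3 * n ^ 4) * (n ^ 2 + 1) = n ^ 2 + 3 * n ^ 7 + 3 * n ^ 5"
        by (simp add: algebra_simps eval_nat_numeral)
      also have "\<dots> \<le> 2 ^ 3 * n ^ 7" using a by simp
      also have "\<dots> \<le> n ^ 3 * n ^ 7" using n2 by (intro mult_right_mono power_mono) auto
      finally show ?thesis by (simp flip: power_add)
    qed
    finally have count: "real (length es + card (\<Union> (set es)) * card C * (length es + 1)) \<le> real n ^ 10"
      by (metis of_nat_le_iff of_nat_power)
    have "exp (- l) = real n powr - 11" using n1 by (simp add: l_def powr_def)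
    moreover have "real n ^ 10 = real n powr 10" using n1 by (simp add: powr_numeral)
    ultimately have "real n ^ 10 * exp (- l) = real n powr 10 * real n powr - 11" by (simp only:)
    also have "\<dots> = real n powr - 1" by (subst powr_add[symmetric]) simp
    finally have expl: "real n ^ 10 * exp (- l) = real n powr - 1" .
    have "measure_pmf.prob (run S L [] es) ?bad
        \<le> real (length es + card (\<Union> (set es)) * card C * (length es + 1)) * exp (- l)"
      using weight_strategy_failure_le[of "trim N" L] T es by (auto simp: S_def T_def V_def)
    also have "\<dots> \<le> real n ^ 10 * exp (- l)" using count by (rule mult_right_mono) simp
    finally show ?thesis using expl by simp
  qed
  moreover have "measure_pmf.prob (run S L [] es) {h. valid_list_edge_coloring E L (coloring_of h)}
     = 1 - measure_pmf.prob (run S L [] es) ?bad"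
    using measure_pmf.prob_compl[of ?bad "run S L [] es"] by (simp add: Compl_eq_Diff_UNIV[symmetric] Collect_neg_eq)
  ultimately show "1 - real n powr - 1 \<le> measure_pmf.prob (output_coloring (weight_algorithm n \<Delta>) L es)
      {col. valid_list_edge_coloring E L col}"
    by (simp add: output_coloring_def weight_algorithm_def S_def N_def vimage_def)
qed

section \<open>Asymptotics of the slack\<close>

lemma q_smallo:
  assumes "(\<lambda>n. real (D n)) \<in> \<omega>(\<lambda>n. ln (real n))"
  shows "(\<lambda>n. q n (D n)) \<in> o(\<lambda>n. real (D n))"
proof -
  have ln_o: "(\<lambda>n. ln (real n)) \<in> o(\<lambda>n. real (D n))"
    using assms by (simp add: smallomega_iff_smallo)
  have "filterlim (\<lambda>n. ln (real n)) at_top sequentially" by real_asymp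
  moreover have "eventually (\<lambda>n. ln (real n) \<le> real (D n)) sequentially"
    using landau_o.smallD[OF ln_o zero_less_one] by eventually_elim auto
  ultimately have lim: "filterlim (\<lambda>n. real (D n)) at_top sequentially"
    by (rule filterlim_at_top_mono)
  \<comment> \<open>This summand depends on the degree only, which tends to infinity because it
    dominates the logarithm.\<close>
  have "(\<lambda>x::real. x powr (3/4) * ln x powr (1/2)) \<in> o(\<lambda>x. x)" by real_asymp
  then have t2: "(\<lambda>n. real (D n) powr (3/4) * ln (real (D n)) powr (1/2)) \<in> o(\<lambda>n. real (D n))"
    using lim by (rule landau_o.small.compose)
  have t3: "(\<lambda>n. real (D n) powr (2/3) * ln (real n) powr (1/3)) \<in> o(\<lambda>n. real (D n))"
  proof (rule landau_o.smallI)
    fix c :: real assume c: "0 < c"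
    \<comment> \<open>The constant is \<open>c ^ 3\<close> because the logarithm enters with
      exponent 1/3.\<close>
    have "eventually (\<lambda>n. norm (ln (real n)) \<le> c ^ 3 * norm (real (D n))) sequentially"
      using c by (intro landau_o.smallD[OF ln_o]) simp
    then show "eventually (\<lambda>n. norm (real (D n) powr (2/3) * ln (real n) powr (1/3)) \<le> c * norm (real (D n))) sequentially"
      using eventually_ge_at_top[of 1]
    proof eventually_elim
      case (elim n)
      then have "ln (real n) powr (1/3) \<le> (c ^ 3 * real (D n)) powr (1/3)"
        by (intro powr_mono2) auto
      also have "\<dots> = c * real (D n) powr (1/3)"
        using c by (simp add: powr_mult powr_powr flip: powr_numeral)
      finally have "real (D n) powr (2/3) * ln (real n) powr (1/3) \<le> real (D n) powr (2/3) * (c * real (D n) powr (1/3))"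
        by (intro mult_left_mono) auto
      also have "\<dots> = c * real (D n)" by (simp add: ac_simps flip: powr_add)
      finally show ?case by simp
    qed
  qed
  have "(\<lambda>n. 10 ^ 24 * ln (real n)) \<in> o(\<lambda>n. real (D n))"
    using ln_o by simp
  moreover have "(\<lambda>n. 10 ^ 4 * (real (D n) powr (3/4) * ln (real (D n)) powr (1/2)
      + real (D n) powr (2/3) * ln (real n) powr (1/3))) \<in> o(\<lambda>n. real (D n))"
    by (subst landau_o.small.cmult_in_iff) (auto intro: sum_in_smallo(1)[OF t2 t3])
  ultimately show ?thesis unfolding q_def by (rule sum_in_smallo(1))
qed

theorem theoremA1:
  "\<exists>(A :: online_algorithm) (c :: real). c > 0 \<and>
     (\<forall>n \<Delta>. list_size_suffices A c n \<Delta> (real \<Delta> + q n \<Delta>)) \<and>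
     (\<forall>D :: nat \<Rightarrow> nat. (\<lambda>n. real (D n)) \<in> \<omega>(\<lambda>n. ln (real n)) \<longrightarrow>
        (\<lambda>n. q n (D n)) \<in> o(\<lambda>n. real (D n)) \<and>
        (\<forall>n. list_size_suffices A c n (D n) (real (D n) + q n (D n))))"
  using list_size_suffices_weight_algorithm q_smallo
  by (intro exI[of _ weight_algorithm] exI[of _ "1::real"]) auto

end
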